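(* Let $p$ be a prime, $q=p^{2h}$ with $h\ge 2$, and let $t\ge 1$ be an integer and $r=2t+1$. Then there exists an $[n,n-r]_q2$ code (covering radius $2$) with \[ n=\Big(2+2\frac{\sqrt{q}-1}{\sqrt{q}\,(\phi(\sqrt{q}\,)-1)}\Big)q^{(r-2)/2}+2\lfloor q^{(r-5)/2}\rfloor+f_q(r,2)\quad\text{if } p\ge 3, \] and there exists an $[n,n-r]_q2$ code with \[ n=\Big(2+\frac{2}{p}+\frac{2}{\sqrt{q}}\Big)q^{(r-2)/2}+2\lfloor q^{(r-5)/2}\rfloor+f_q(r,2)\quad\text{if } p\ge 7. \]
   Context: $\phi(Q)$ denotes the order of the largest proper subfield of $\mathbb{F}_Q$. For integers $r,R$: $f_q(r,R)=0$ if $r\notin\{\frac{9R}{2},\frac{13R}{2}\}$, and $f_q(r,R)=q^{(r-3R)/R-0.5}+q^{(r-4R)/R-0.5}$ if $r\in\{\frac{9R}{2},\frac{13R}{2}\}$. An $[n,n-r]_qR$ code is a $q$-ary linear code of length $n$, codimension $r$ and covering radius $R$, where the covering radius is the least $R$ such that every column of $\mathbb{F}_q^r$ is a linear combination of at most $R$ columns of a parity check matrix. *)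

theory Defs
  imports
    Complex_Main
    "HOL-Computational_Algebra.Primes"
    "HOL-Algebra.Subrings"
    "Jordan_Normal_Form.Matrix_Kernel"
begin

(* The fields of order Q are taken with carrier inside nat; every finite field is
   isomorphic to such a one. The set has no maximum (and the value is unspecified)
   when there is no field of order Q or no proper subfield, i.e. unless Q is a
   prime power with exponent at least 2. *)
definition largest_proper_subfield_order :: "nat \<Rightarrow> nat" ("\<phi>") where
  "\<phi> Q = Max {card K | K (F :: nat ring).
     field F \<and> finite (carrier F) \<and> card (carrier F) = Q \<and>
     subfield K F \<and> K \<noteq> carrier F}"

definition f_extra :: "nat \<Rightarrow> nat \<Rightarrow> nat \<Rightarrow> real" where
  "f_extra q r R =
     (if real r \<in> {9 * real R / 2, 13 * real R / 2}
      then real q powr ((real r - 3 * real R) / real R - 0.5)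
         + real q powr ((real r - 4 * real R) / real R - 0.5)
      else 0)"

definition linear_code :: "nat \<Rightarrow> nat \<Rightarrow> 'a::field vec set \<Rightarrow> bool" where
  "linear_code n k C \<longleftrightarrow>
     VectorSpace.subspace class_ring C (module_vec TYPE('a) n) \<and>
     vectorspace.dim class_ring ((module_vec TYPE('a) n)\<lparr>carrier := C\<rparr>) = k"

(* For a code of length n and dimension n - r, a matrix of this kind
   automatically has full row rank r. *)
definition parity_check_matrix :: "nat \<Rightarrow> nat \<Rightarrow> 'a::field vec set \<Rightarrow> 'a mat \<Rightarrow> bool" where
  "parity_check_matrix n r C H \<longleftrightarrow> H \<in> carrier_mat r n \<and> C = mat_kernel H"

definition columns_cover :: "'a::field mat \<Rightarrow> nat \<Rightarrow> bool" where
  "columns_cover H R \<longleftrightarrow>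
     (\<forall>s \<in> carrier_vec (dim_row H).
        \<exists>J c. J \<subseteq> {..<dim_col H} \<and> card J \<le> R \<and>
          s = finsum_vec TYPE('a) (dim_row H) (\<lambda>j. c j \<cdot>\<^sub>v col H j) J)"

definition has_covering_radius :: "'a::field mat \<Rightarrow> nat \<Rightarrow> bool" where
  "has_covering_radius H R \<longleftrightarrow>
     columns_cover H R \<and> (\<forall>R'. columns_cover H R' \<longrightarrow> R \<le> R')"

(* C is an [n, n - r]_q R code, where q is the order of the field 'a. Any two
   parity check matrices of C differ by an invertible row transformation, so the
   covering radius does not depend on the choice of H. *)
definition covering_code :: "nat \<Rightarrow> nat \<Rightarrow> nat \<Rightarrow> 'a::field vec set \<Rightarrow> bool" where
  "covering_code n r R C \<longleftrightarrow>
     r \<le> n \<and> linear_code n (n - r) C \<and>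
     (\<exists>H. parity_check_matrix n r C H \<and> has_covering_radius H R)"

end

theory Submission
  imports Defs "HOL-Number_Theory.Residues" "HOL-Algebra.Weak_Morphisms"
begin

text \<open>
  Let \<open>Q\<close> be the square root of \<open>q\<close>, \<open>s = \<phi> Q\<close>, and \<open>k < K\<close> the subfields of orders \<open>s\<close> and \<open>Q\<close>.
  For \<open>r = 3\<close> the columns are the points of two disjoint \<open>k\<close>-linear blocking sets
  \<open>{(x, U x, b)}\<close> and \<open>{(e, y, T y + \<theta> e)}\<close> of the Baer subplane over \<open>K\<close>, each with at most
  \<open>Q + Q/s + 1\<close> points. Each meets all \<open>K\<close>-lines by pigeonhole, and every vector over the large
  field lies on some \<open>K\<close>-line, again by pigeonhole. The sets are disjoint as soon as
  \<open>U (1 / (\<tau> + \<theta>)) \<noteq> \<tau>\<close> on \<open>k\<close>, where \<open>T 1 = 0\<close> and \<open>T \<theta> = 1\<close>.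

  From codimension \<open>r\<close> to \<open>r + 2\<close> a column \<open>h\<close> is replaced by the \<open>q\<close> columns \<open>(h, \<xi>, \<beta> \<xi>)\<close> with a
  slope \<open>\<beta> = \<beta>(h)\<close>, possibly infinite. If \<open>s = c h + d h'\<close> with \<open>c, d \<noteq> 0\<close> and different slopes,
  then all \<open>(s, u, v)\<close> are covered; the vectors \<open>(0, u, v)\<close> are covered because every slope occurs.
  The lengths obtained never exceed the prescribed ones, and zero columns make up the difference;
  in particular the summand \<open>f_extra\<close> consists of padding only.
\<close>

section \<open>Codes from covering families of columns\<close>

text \<open>Rank-nullity: \<open>H\<close> is onto, so its image has dimension \<open>r\<close> and
  its kernel dimension \<open>N - r\<close>.\<close>

lemma linear_code_mat_kernel:
  fixes H :: "'a::field mat"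
  assumes H: "H \<in> carrier_mat r N"
    and surj: "\<And>w. w \<in> carrier_vec r \<Longrightarrow> \<exists>v \<in> carrier_vec N. H *\<^sub>v v = w"
  shows "r \<le> N" and "linear_code N (N - r) (mat_kernel H)"
proof -
  interpret V: vec_space "TYPE('a)" N .
  interpret W: vec_space "TYPE('a)" r .
  interpret lin: linear_map class_ring "module_vec TYPE('a) N" "module_vec TYPE('a) r" "\<lambda>v. H *\<^sub>v v"
    by unfold_locales
      (use H in \<open>auto simp: module_hom_def module_vec_simps mult_add_distrib_mat_vec mult_mat_vec\<close>)
  have ker: "lin.kerT = mat_kernel H"
    using H by (auto simp: lin.ker_def mat_kernel module_vec_simps)
  have "(\<lambda>v. H *\<^sub>v v) ` carrier (module_vec TYPE('a) N) = carrier (module_vec TYPE('a) r)"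
    using H surj by (fastforce simp: module_vec_simps)
  then have im: "lin.imT = carrier (module_vec TYPE('a) r)"
    by (simp add: lin.im_def)
  have self: "(module_vec TYPE('a) r)\<lparr>carrier := carrier (module_vec TYPE('a) r)\<rparr> = module_vec TYPE('a) r"
    by simp
  have "r + vectorspace.dim class_ring ((module_vec TYPE('a) N)\<lparr>carrier := mat_kernel H\<rparr>) = N"
    using lin.rank_nullity_main(1)[OF V.fin_dim] unfolding ker im self W.dim_is_n V.dim_is_n .
  moreover have "VectorSpace.subspace class_ring (mat_kernel H) (module_vec TYPE('a) N)"
    using lin.kerT_is_subspace unfolding ker .
  ultimately show "r \<le> N" "linear_code N (N - r) (mat_kernel H)"
    unfolding linear_code_def by auto
qed

lemma card_carrier_vec: "card (carrier_vec n :: 'a::finite vec set) = card (UNIV :: 'a set) ^ n"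
proof -
  have "carrier_vec n = vec_of_list ` {xs :: 'a list. set xs \<subseteq> UNIV \<and> length xs = n}"
  proof
    show "carrier_vec n \<subseteq> vec_of_list ` {xs :: 'a list. set xs \<subseteq> UNIV \<and> length xs = n}"
    proof
      fix v :: "'a vec" assume "v \<in> carrier_vec n"
      then show "v \<in> vec_of_list ` {xs :: 'a list. set xs \<subseteq> UNIV \<and> length xs = n}"
        by (intro image_eqI[of _ _ "list_of_vec v"]) (auto simp: vec_list)
    qed
  qed (auto intro: carrier_vecI)
  moreover have "inj (vec_of_list :: 'a list \<Rightarrow> 'a vec)"
    by (metis injI list_vec)
  ultimately show ?thesis
    using card_lists_length_eq[of "UNIV :: 'a set" n] by (simp add: card_image inj_on_subset)
qed

text \<open>The columns from \<open>n\<close> to \<open>N - 1\<close> are zero, which pads the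
  length without disturbing the covering. Radius at most 1 is excluded by counting: the multiples of
  single columns number at most \<open>N\<close> times the field order, which is less than the
  number of vectors of length \<open>r\<close>.\<close>

lemma covering_codeI:
  fixes h :: "nat \<Rightarrow> nat \<Rightarrow> 'a::{finite,field}"
  assumes nN: "n \<le> N" and N: "N < card (UNIV :: 'a set) ^ (r - 1)" and r: "0 < r"
    and sat: "\<And>s. \<exists>x<r. s x \<noteq> 0 \<Longrightarrow>
      \<exists>i<n. \<exists>j<n. \<exists>c d. i \<noteq> j \<and> (\<forall>x<r. s x = c * h i x + d * h j x)"
  shows "\<exists>C :: 'a vec set. covering_code N r 2 C"
proof -
  let ?q = "card (UNIV :: 'a set)"
  define H where "H = mat r N (\<lambda>(x, i). if i < n then h i x else 0)"
  have H: "H \<in> carrier_mat r N" "dim_row H = r" "dim_col H = N"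
    by (auto simp: H_def)
  have ix: "H $$ (x, i) = h i x" if "i < n" "x < r" for i x
    using that nN by (simp add: H_def)
  have cover: "\<exists>J c. J \<subseteq> {..<N} \<and> card J \<le> 2 \<and> w = finsum_vec TYPE('a) r (\<lambda>j. c j \<cdot>\<^sub>v col H j) J"
    if w: "w \<in> carrier_vec r" for w
  proof (cases "w = 0\<^sub>v r")
    case True
    then show ?thesis
      by (intro exI[of _ "{}"] exI[of _ "\<lambda>_. 0"]) (simp add: finsum_vec_empty)
  next
    case False
    then have "\<exists>x<r. w $ x \<noteq> 0"
      using w by (auto simp: vec_eq_iff)
    then obtain i j c d where ij: "i < n" "j < n" "i \<noteq> j"
      and eq: "\<And>x. x < r \<Longrightarrow> w $ x = c * h i x + d * h j x"
      using sat[of "\<lambda>x. w $ x"] by blast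
    \<comment> \<open>Distinct indices let one function carry both coefficients.\<close>
    let ?c = "\<lambda>k. if k = i then c else d"
    have car: "(\<lambda>k. ?c k \<cdot>\<^sub>v col H k) \<in> {i, j} \<rightarrow> carrier_vec r"
      using H by auto
    have "w = finsum_vec TYPE('a) r (\<lambda>k. ?c k \<cdot>\<^sub>v col H k) {i, j}"
    proof (rule eq_vecI)
      show "dim_vec w = dim_vec (finsum_vec TYPE('a) r (\<lambda>k. ?c k \<cdot>\<^sub>v col H k) {i, j})"
        using w finsum_vec_closed[OF car] by auto
    next
      fix x assume "x < dim_vec (finsum_vec TYPE('a) r (\<lambda>k. ?c k \<cdot>\<^sub>v col H k) {i, j})"
      then have x: "x < r"
        using finsum_vec_closed[OF car] by auto
      show "w $ x = finsum_vec TYPE('a) r (\<lambda>k. ?c k \<cdot>\<^sub>v col H k) {i, j} $ x"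
        unfolding eq[OF x] using ij x H nN by (subst index_finsum_vec[OF _ x car]) (simp_all add: ix)
    qed
    moreover have "{i, j} \<subseteq> {..<N}" "card {i, j} \<le> 2"
      using ij nN by (auto simp: card_insert_if)
    ultimately show ?thesis
      by (intro exI[of _ "{i, j}"] exI[of _ ?c] conjI)
  qed
  then have cc: "columns_cover H 2"
    unfolding columns_cover_def H(2,3) by (intro ballI)
  have surj: "\<exists>v \<in> carrier_vec N. H *\<^sub>v v = w" if w: "w \<in> carrier_vec r" for w
  proof -
    obtain J c where J: "J \<subseteq> {..<N}" and eq: "w = finsum_vec TYPE('a) r (\<lambda>j. c j \<cdot>\<^sub>v col H j) J"
      using cover[OF w] by blast
    have fin: "finite J"
      using J finite_subset by blast
    have car: "(\<lambda>k. c k \<cdot>\<^sub>v col H k) \<in> J \<rightarrow> carrier_vec r"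
      using H by auto
    define v where "v = vec N (\<lambda>j. if j \<in> J then c j else 0)"
    have "H *\<^sub>v v = w"
    proof (rule eq_vecI)
      show "dim_vec (H *\<^sub>v v) = dim_vec w"
        using w H by auto
      fix x assume "x < dim_vec w"
      then have x: "x < r" using w by auto
      have "(H *\<^sub>v v) $ x = (\<Sum>j = 0..<N. if j \<in> J then c j * H $$ (x, j) else 0)"
        using x H by (auto simp: scalar_prod_def v_def intro!: sum.cong)
      also have "\<dots> = (\<Sum>j \<in> J. c j * H $$ (x, j))"
        using J by (auto simp: sum.If_cases intro!: sum.cong)
      also have "\<dots> = w $ x"
        unfolding eq using x H J by (subst index_finsum_vec[OF fin x car]) (auto intro!: sum.cong)
      finally show "(H *\<^sub>v v) $ x = w $ x" .
    qed
    then show ?thesis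
      by (intro bexI[of _ v]) (auto simp: v_def)
  qed
  have "2 \<le> R'" if R': "columns_cover H R'" for R'
  proof (rule ccontr)
    assume "\<not> 2 \<le> R'"
    then have R1: "R' \<le> 1" by simp
    have "r \<le> N"
      using linear_code_mat_kernel(1)[OF H(1) surj] .
    with r have "0 < N" by simp
    have "carrier_vec r \<subseteq> (\<lambda>(i, c). c \<cdot>\<^sub>v col H i) ` ({..<N} \<times> UNIV)"
    proof
      fix w :: "'a vec" assume w: "w \<in> carrier_vec r"
      obtain J c where J: "J \<subseteq> {..<N}" "card J \<le> R'"
        and eq: "w = finsum_vec TYPE('a) r (\<lambda>j. c j \<cdot>\<^sub>v col H j) J"
        using R' w unfolding columns_cover_def H by blast
      have "finite J"
        using J finite_subset by blast
      then consider "J = {}" | j where "J = {j}"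
        using J R1 by (metis One_nat_def card_0_eq card_1_singletonE le_Suc_eq le_zero_eq order_trans)
      then show "w \<in> (\<lambda>(i, c). c \<cdot>\<^sub>v col H i) ` ({..<N} \<times> UNIV)"
      proof cases
        case 1
        \<comment> \<open>The empty combination is the zero multiple of column 0, which exists since
          \<open>r \<le> N\<close> and \<open>0 < r\<close>.\<close>
        then have "w = 0 \<cdot>\<^sub>v col H 0"
          using eq H by (auto simp: finsum_vec_empty intro!: eq_vecI)
        then show ?thesis
          using \<open>0 < N\<close> by force
      next
        case 2
        have car: "(\<lambda>k. c k \<cdot>\<^sub>v col H k) \<in> {j} \<rightarrow> carrier_vec r"
          using H by auto
        have "w = c j \<cdot>\<^sub>v col H j"
        proof (rule eq_vecI)
          show "dim_vec w = dim_vec (c j \<cdot>\<^sub>v col H j)"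
            using w H by auto
          fix x assume "x < dim_vec (c j \<cdot>\<^sub>v col H j)"
          then have x: "x < r" using H by auto
          show "w $ x = (c j \<cdot>\<^sub>v col H j) $ x"
            unfolding eq 2 by (subst index_finsum_vec[OF _ x car]) auto
        qed
        then show ?thesis
          using 2 J by auto
      qed
    qed
    then have "card (carrier_vec r :: 'a vec set) \<le> card ({..<N} \<times> (UNIV :: 'a set))"
      by (intro surj_card_le) auto
    moreover have "card (carrier_vec r :: 'a vec set) = ?q ^ r"
      by (rule card_carrier_vec)
    ultimately have "?q ^ r \<le> N * ?q"
      by (simp add: card_cartesian_product)
    moreover have "?q ^ r = ?q ^ (r - 1) * ?q"
      using r by (metis Suc_diff_1 power_Suc2)
    moreover have "0 < ?q"
      by (simp add: finite_UNIV_card_ge_0)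
    ultimately show False
      using N by simp
  qed
  then have "has_covering_radius H 2"
    using cc unfolding has_covering_radius_def by blast
  then show ?thesis
    using linear_code_mat_kernel[OF H(1) surj] H(1)
    unfolding covering_code_def parity_check_matrix_def by blast
qed

section \<open>Increasing the codimension by two\<close>

text \<open>The points of the projective line as direction vectors; \<open>None\<close> is the
  infinite slope.\<close>

fun slope_vec :: "'a::field option \<Rightarrow> 'a \<times> 'a" where
  "slope_vec None = (0, 1)"
| "slope_vec (Some b) = (1, b)"

lemma slope_vec_exists:
  fixes u v :: "'a::field"
  assumes "u \<noteq> 0 \<or> v \<noteq> 0"
  shows "\<exists>\<sigma> w. w \<noteq> 0 \<and> u = w * fst (slope_vec \<sigma>) \<and> v = w * snd (slope_vec \<sigma>)"
proof (cases "u = 0")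
  case True
  then show ?thesis
    using assms by (intro exI[of _ None] exI[of _ v]) auto
next
  case False
  then show ?thesis
    by (intro exI[of _ "Some (v / u)"] exI[of _ u]) auto
qed

text \<open>Direction vectors of different slopes form a basis of the plane, and the nonzero factors
  \<open>c\<close>, \<open>d\<close> can be divided out. This is why the lifting asks for coverings
  with two nonzero coefficients.\<close>

lemma slope_vec_solve:
  fixes u v c d :: "'a::field"
  assumes "\<sigma> \<noteq> \<tau>" "c \<noteq> 0" "d \<noteq> 0"
  shows "\<exists>\<xi> \<eta>. u = c * (\<xi> * fst (slope_vec \<sigma>)) + d * (\<eta> * fst (slope_vec \<tau>)) \<and>
    v = c * (\<xi> * snd (slope_vec \<sigma>)) + d * (\<eta> * snd (slope_vec \<tau>))"
proof (cases \<sigma>)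
  case None
  then obtain b where b: "\<tau> = Some b"
    using assms(1) by (cases \<tau>) auto
  show ?thesis
    using assms None b by (intro exI[of _ "(v - u * b) / c"] exI[of _ "u / d"]) (simp add: field_simps)
next
  case (Some a)
  show ?thesis
  proof (cases \<tau>)
    case None
    then show ?thesis
      using assms Some by (intro exI[of _ "u / c"] exI[of _ "(v - u * a) / d"]) (simp add: field_simps)
  next
    case (Some b)
    with \<open>\<sigma> = Some a\<close> have "b - a \<noteq> 0"
      using assms(1) by auto
    \<comment> \<open>Solves \<open>x + y = u\<close>, \<open>x * a + y * b = v\<close>, where
      \<open>x = u - y\<close>.\<close>
    define y where "y = (v - u * a) / (b - a)"
    have "y * (b - a) = v - u * a"
      using \<open>b - a \<noteq> 0\<close> by (simp add: y_def)
    then have "v = (u - y) * a + y * b"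
      by (simp add: algebra_simps)
    then show ?thesis
      using assms Some \<open>\<sigma> = Some a\<close>
      by (intro exI[of _ "(u - y) / c"] exI[of _ "y / d"]) simp
  qed
qed

section \<open>Iterated lifting with slopes divided into classes\<close>

text \<open>
  Bookkeeping for the iterated lifting. The columns are divided into \<open>m\<close> classes, which keep
  disjoint sets of slopes; state 0 means that the column may still be used to produce the zero
  vector, and states 1 and 2 mark the two halves of a pair that does so. Only columns whose
  classes differ, or whose states are 1 and 2, have to be given different slopes later on.
\<close>

definition compatible :: "('i \<Rightarrow> nat) \<Rightarrow> ('i \<Rightarrow> nat) \<Rightarrow> 'i \<Rightarrow> 'i \<Rightarrow> bool" where
  "compatible cls st i j \<longleftrightarrow> cls i \<noteq> cls j \<or> {st i, st j} = {1, 2}"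

text \<open>The invariant of the iteration. \<open>g\<close> distributes the slopes over the
  classes, so columns of different classes never receive equal slopes. The injection
  \<open>\<psi>\<close> reserves for every slope a free column of its class, to be given exactly
  that slope in the next step.\<close>

definition liftable :: "('a::field option \<Rightarrow> nat) \<Rightarrow> nat \<Rightarrow> nat \<Rightarrow> nat \<Rightarrow> (nat \<Rightarrow> nat \<Rightarrow> 'a) \<Rightarrow>
    (nat \<Rightarrow> nat) \<Rightarrow> (nat \<Rightarrow> nat) \<Rightarrow> ('a option \<Rightarrow> nat) \<Rightarrow> bool" where
  "liftable g m r n h cls st \<psi> \<longleftrightarrow>
     (\<forall>s. (\<exists>x<r. s x \<noteq> 0) \<longrightarrow>
        (\<exists>i<n. \<exists>j<n. \<exists>c d. c \<noteq> 0 \<and> d \<noteq> 0 \<and> compatible cls st i j \<and>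
           (\<forall>x<r. s x = c * h i x + d * h j x))) \<and>
     (\<forall>i<n. cls i < m) \<and>
     inj \<psi> \<and> (\<forall>\<sigma>. \<psi> \<sigma> < n \<and> st (\<psi> \<sigma>) = 0 \<and> cls (\<psi> \<sigma>) = g \<sigma>)"

definition extend_vec :: "nat \<Rightarrow> (nat \<Rightarrow> 'a) \<Rightarrow> 'a \<times> 'a::field \<Rightarrow> 'a \<Rightarrow> nat \<Rightarrow> 'a" where
  "extend_vec r f p \<xi> x = (if x < r then f x else if x = r then \<xi> * fst p else \<xi> * snd p)"

lemma extend_vec_combination:
  assumes "\<And>x. x < r \<Longrightarrow> s x = c * f x + d * f' x"
    and "s r = c * (\<xi> * fst p) + d * (\<eta> * fst p')"
    and "s (Suc r) = c * (\<xi> * snd p) + d * (\<eta> * snd p')"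
  shows "\<forall>x<r + 2. s x = c * extend_vec r f p \<xi> x + d * extend_vec r f' p' \<eta> x"
proof (intro allI impI)
  fix x assume "x < r + 2"
  then consider "x < r" | "x = r" | "x = Suc r"
    by linarith
  then show "s x = c * extend_vec r f p \<xi> x + d * extend_vec r f' p' \<eta> x"
    by cases (use assms in \<open>auto simp: extend_vec_def\<close>)
qed

text \<open>
  The representatives \<open>\<psi>\<close> make every slope occur on a free column. A vector \<open>(0, w p)\<close> with
  \<open>p\<close> of slope \<open>\<sigma>\<close> is then \<open>w\<close> times the difference of two extensions of the column \<open>\<psi> \<sigma>\<close>.
\<close>

lemma liftable_step:
  fixes h :: "nat \<Rightarrow> nat \<Rightarrow> 'a::field" and e :: "nat \<Rightarrow> 'a"
  assumes L: "liftable g m r n h cls st \<psi>"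
    and e: "bij_betw e {..<q} UNIV" "e 0 = 0" "e 1 = 1" and q: "3 \<le> q"
    and ab: "\<And>c. c < m \<Longrightarrow> g (a c) = c" "\<And>c. c < m \<Longrightarrow> g (b c) = c" "\<And>c. c < m \<Longrightarrow> a c \<noteq> b c"
  shows "\<exists>h' cls' st' \<psi>'. liftable g m (r + 2) (n * q) h' cls' st' \<psi>'"
proof -
  have span: "\<exists>i<n. \<exists>j<n. \<exists>c d. c \<noteq> 0 \<and> d \<noteq> 0 \<and> compatible cls st i j \<and>
      (\<forall>x<r. s x = c * h i x + d * h j x)" if "\<exists>x<r. s x \<noteq> 0" for s
    using L that unfolding liftable_def by blast
  have cls: "\<And>i. i < n \<Longrightarrow> cls i < m" and inj: "inj \<psi>"
    and \<psi>: "\<And>\<sigma>. \<psi> \<sigma> < n" "\<And>\<sigma>. st (\<psi> \<sigma>) = 0" "\<And>\<sigma>. cls (\<psi> \<sigma>) = g \<sigma>"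
    using L unfolding liftable_def by blast+
  \<comment> \<open>A reserved column takes the slope it is reserved for. Every other column takes
    one of two fixed slopes of its class, chosen by the state, so that states 1 and 2 within a class
    are told apart.\<close>
  define \<beta> where "\<beta> i = (if i \<in> range \<psi> then inv_into UNIV \<psi> i else if st i = 2 then b (cls i) else a (cls i))" for i
  have \<beta>\<psi>: "\<beta> (\<psi> \<sigma>) = \<sigma>" for \<sigma>
    using inj by (simp add: \<beta>_def)
  have g\<beta>: "g (\<beta> i) = cls i" if "i < n" for i
    using \<psi> ab cls[OF that] inj by (auto simp: \<beta>_def)
  have not_free: "i \<notin> range \<psi>" if "st i \<noteq> 0" for i
    using that \<psi> by auto
  have \<beta>_neq: "\<beta> i \<noteq> \<beta> j" if ij: "i < n" "j < n" "compatible cls st i j" for i j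
  proof (cases "cls i = cls j")
    case True
    then have "{st i, st j} = {1, 2}"
      using ij by (simp add: compatible_def)
    then have "st i = 1 \<and> st j = 2 \<or> st i = 2 \<and> st j = 1"
      by (auto simp: doubleton_eq_iff)
    then show ?thesis
      using not_free[of i] not_free[of j] ab(3)[OF cls[OF ij(1)]] True by (auto simp: \<beta>_def)
  next
    case False
    then show ?thesis
      using g\<beta> ij by metis
  qed
  define E where "E = inv_into {..<q} e"
  have E: "E \<xi> < q" "e (E \<xi>) = \<xi>" for \<xi>
    using e(1) bij_betw_inv_into_right[OF e(1)] inv_into_into[of \<xi> e "{..<q}"]
    unfolding E_def bij_betw_def by auto
  have E01: "E 0 = 0" "E 1 = 1"
    using bij_betw_inv_into_left[OF e(1), of 0] bij_betw_inv_into_left[OF e(1), of 1] e(2,3) q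
    by (simp_all add: E_def)
  \<comment> \<open>Column \<open>i\<close> extended by the scalar \<open>\<xi>\<close> is stored in
    block \<open>i\<close> at offset \<open>E \<xi>\<close>; the scalars 0 and 1 have offsets 0 and
    1.\<close>
  define J where "J i \<xi> = i * q + E \<xi>" for i \<xi>
  have J: "J i \<xi> div q = i" "J i \<xi> mod q = E \<xi>" for i \<xi>
    using E(1)[of \<xi>] by (auto simp: J_def)
  have Jn: "J i \<xi> < n * q" if "i < n" for i \<xi>
  proof -
    have "J i \<xi> < Suc i * q"
      using E(1)[of \<xi>] by (simp add: J_def)
    also have "\<dots> \<le> n * q"
      using that by (intro mult_le_mono1) auto
    finally show ?thesis .
  qed
  define h' where "h' k = extend_vec r (h (k div q)) (slope_vec (\<beta> (k div q))) (e (k mod q))" for k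
  define cls' where "cls' k = cls (k div q)" for k
  \<comment> \<open>The extensions of a reserved column by 0 and 1 become the pair that produces its
    direction vector; its other extensions stay free. Unreserved columns pass on their
    state.\<close>
  define st' where "st' k = (if k div q \<in> range \<psi>
      then if k mod q = 0 then 1 else if k mod q = 1 then 2 else 0 else st (k div q))" for k
  \<comment> \<open>Offset 2 is the first one left free, whence \<open>3 \<le> q\<close>.\<close>
  define \<psi>' where "\<psi>' \<sigma> = \<psi> \<sigma> * q + 2" for \<sigma>
  have h'J: "h' (J i \<xi>) = extend_vec r (h i) (slope_vec (\<beta> i)) \<xi>" for i \<xi>
    by (simp add: h'_def J E)
  have "liftable g m (r + 2) (n * q) h' cls' st' \<psi>'"
    unfolding liftable_def
  proof (intro conjI allI impI)
    fix s :: "nat \<Rightarrow> 'a" assume nz: "\<exists>x<r + 2. s x \<noteq> 0"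
    show "\<exists>i<n * q. \<exists>j<n * q. \<exists>c d. c \<noteq> 0 \<and> d \<noteq> 0 \<and> compatible cls' st' i j \<and>
        (\<forall>x<r + 2. s x = c * h' i x + d * h' j x)"
    proof (cases "\<exists>x<r. s x \<noteq> 0")
      case True
      from span[OF True] obtain i j c d where ij: "i < n" "j < n" and cd: "c \<noteq> 0" "d \<noteq> 0"
        and co: "compatible cls st i j" and eq: "\<forall>x<r. s x = c * h i x + d * h j x"
        by blast
      obtain \<xi> \<eta> where sol: "s r = c * (\<xi> * fst (slope_vec (\<beta> i))) + d * (\<eta> * fst (slope_vec (\<beta> j)))"
        "s (Suc r) = c * (\<xi> * snd (slope_vec (\<beta> i))) + d * (\<eta> * snd (slope_vec (\<beta> j)))"
        using slope_vec_solve[OF \<beta>_neq[OF ij co] cd] by blast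
      have "compatible cls' st' (J i \<xi>) (J j \<eta>)"
      proof (cases "cls i = cls j")
        case True
        then have *: "{st i, st j} = {1, 2}"
          using co by (simp add: compatible_def)
        then have "st i \<noteq> 0" "st j \<noteq> 0"
          by (auto simp: doubleton_eq_iff)
        then show ?thesis
          using not_free * by (simp add: compatible_def st'_def J)
      qed (simp add: compatible_def cls'_def J)
      moreover have "\<forall>x<r + 2. s x = c * h' (J i \<xi>) x + d * h' (J j \<eta>) x"
        unfolding h'J using eq sol by (intro extend_vec_combination) auto
      ultimately show ?thesis
        using Jn[OF ij(1)] Jn[OF ij(2)] cd by blast
    next
      case False
      then have "s r \<noteq> 0 \<or> s (Suc r) \<noteq> 0"
        using nz by (metis add_2_eq_Suc' less_Suc_eq)
      then obtain \<sigma> w where w: "w \<noteq> 0" "s r = w * fst (slope_vec \<sigma>)" "s (Suc r) = w * snd (slope_vec \<sigma>)"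
        using slope_vec_exists by blast
      have "compatible cls' st' (J (\<psi> \<sigma>) 1) (J (\<psi> \<sigma>) 0)"
        by (auto simp: compatible_def st'_def J E01)
      moreover have "\<forall>x<r + 2. s x = w * h' (J (\<psi> \<sigma>) 1) x + (- w) * h' (J (\<psi> \<sigma>) 0) x"
        unfolding h'J using False w by (intro extend_vec_combination) (auto simp: \<beta>\<psi>)
      moreover have "- w \<noteq> 0"
        using w by simp
      ultimately show ?thesis
        using Jn[OF \<psi>(1)] w(1) by blast
    qed
  next
    fix i assume "i < n * q"
    then show "cls' i < m"
      using cls by (simp add: cls'_def less_mult_imp_div_less)
  next
    show "inj \<psi>'"
      using inj q by (auto simp: \<psi>'_def inj_def)
  next
    fix \<sigma>
    have "(x * q + y) div q = x" "(x * q + y) mod q = y" if "y < q" for x y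
      using that by auto
    from this[of 2] have "\<psi>' \<sigma> div q = \<psi> \<sigma>" "\<psi>' \<sigma> mod q = 2"
      using q by (auto simp: \<psi>'_def)
    then show "st' (\<psi>' \<sigma>) = 0" "cls' (\<psi>' \<sigma>) = g \<sigma>"
      using \<psi> by (auto simp: st'_def cls'_def)
    have "\<psi>' \<sigma> < Suc (\<psi> \<sigma>) * q"
      using q by (simp add: \<psi>'_def)
    also have "\<dots> \<le> n * q"
      using \<psi>(1)[of \<sigma>] by (intro mult_le_mono1) auto
    finally show "\<psi>' \<sigma> < n * q" .
  qed
  then show ?thesis
    by blast
qed

text \<open>
  In the first step only \<open>m\<close> slopes occur. Two extra columns of slopes 0 and infinity cover the
  remaining vectors \<open>(0, u, v)\<close>.
\<close>

lemma liftable_base: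
  fixes g :: "'a::field option \<Rightarrow> nat" and h :: "nat \<Rightarrow> nat \<Rightarrow> 'a" and e :: "nat \<Rightarrow> 'a"
  assumes span: "\<And>s. \<exists>x<r. s x \<noteq> 0 \<Longrightarrow>
      \<exists>i<m. \<exists>j<m. \<exists>c d. i \<noteq> j \<and> c \<noteq> 0 \<and> d \<noteq> 0 \<and> (\<forall>x<r. s x = c * h i x + d * h j x)"
    and e: "bij_betw e {..<q} UNIV" "e 0 = 0" "e 1 = 1" and m: "2 \<le> m" "m \<le> q"
    and g: "\<And>\<sigma>. g \<sigma> < m"
    and \<tau>: "\<And>\<sigma>. \<tau> \<sigma> < q" "\<And>\<sigma>. 2 \<le> \<tau> \<sigma>" "\<And>\<sigma> \<sigma>'. g \<sigma> = g \<sigma>' \<Longrightarrow> \<tau> \<sigma> = \<tau> \<sigma>' \<Longrightarrow> \<sigma> = \<sigma>'"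
  shows "\<exists>h' cls' st' \<psi>'. liftable g m (r + 2) (m * q + 2) h' cls' st' \<psi>'"
proof -
  \<comment> \<open>For \<open>2 \<le> i < m\<close> the argument \<open>i - 1\<close> is positive
    and below \<open>q\<close>, so by injectivity of \<open>e\<close> and \<open>e 0 = 0\<close> no
    slope is repeated.\<close>
  define \<beta> where "\<beta> i = (if i = 0 then Some 0 else if i = 1 then None else Some (e (i - 1)))" for i :: nat
  have \<beta>_neq: "\<beta> i \<noteq> \<beta> j" if ij: "i < m" "j < m" "i \<noteq> j" for i j
  proof -
    have inj: "k = l" if "e k = e l" "k < q" "l < q" for k l
      using e(1) that unfolding bij_betw_def by (auto dest: inj_onD)
    have ne0: "e (k - 1) \<noteq> 0" if "k \<noteq> 0" "k \<noteq> 1" "k < m" for k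
    proof -
      have "0 < k - 1" "k - 1 < q" "0 < q"
        using that m by linarith+
      then show ?thesis
        using inj[of "k - 1" 0] e(2) by auto
    qed
    have ne: "e (i - 1) \<noteq> e (j - 1)" if "i \<noteq> 0" "j \<noteq> 0"
      using inj[of "i - 1" "j - 1"] ij m that by linarith
    show ?thesis
      using ne0[of i] ne0[of j] ne ij unfolding \<beta>_def by (simp split: if_split)
  qed
  define E where "E = inv_into {..<q} e"
  have E: "E \<xi> < q" "e (E \<xi>) = \<xi>" for \<xi>
    using e(1) bij_betw_inv_into_right[OF e(1)] inv_into_into[of \<xi> e "{..<q}"]
    unfolding E_def bij_betw_def by auto
  have E01: "E 0 = 0" "E 1 = 1"
    using bij_betw_inv_into_left[OF e(1), of 0] bij_betw_inv_into_left[OF e(1), of 1] e(2,3) m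
    by (simp_all add: E_def)
  define J where "J i \<xi> = i * q + E \<xi>" for i \<xi>
  have J: "J i \<xi> div q = i" "J i \<xi> mod q = E \<xi>" for i \<xi>
    using E(1)[of \<xi>] by (auto simp: J_def)
  have Jm: "J i \<xi> < m * q" if "i < m" for i \<xi>
  proof -
    have "J i \<xi> < Suc i * q"
      using E(1)[of \<xi>] by (simp add: J_def)
    also have "\<dots> \<le> m * q"
      using that by (intro mult_le_mono1) auto
    finally show ?thesis .
  qed
  define h' where "h' k = (if k < m * q
      then extend_vec r (h (k div q)) (slope_vec (\<beta> (k div q))) (e (k mod q))
      else extend_vec r (\<lambda>_. 0) (slope_vec (if k = m * q then Some 0 else None)) 1)" for k
  \<comment> \<open>The two extra columns get different classes, which makes them compatible; this
    needs \<open>2 \<le> m\<close>.\<close>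
  define cls' where "cls' k = (if k < m * q then k div q else if k = m * q then 0 else 1)" for k
  \<comment> \<open>Only blocks 0 and 1, of slopes 0 and infinity, need a pair. The free offsets
    there start at 2, which is the lower bound on \<open>\<tau>\<close>.\<close>
  define st' where "st' k = (if k < m * q \<and> k div q < 2
      then if k mod q = 0 then 1 else if k mod q = 1 then 2 else 0 else 0 :: nat)" for k
  define \<psi>' where "\<psi>' \<sigma> = g \<sigma> * q + \<tau> \<sigma>" for \<sigma>
  have h'J: "h' (J i \<xi>) = extend_vec r (h i) (slope_vec (\<beta> i)) \<xi>" if "i < m" for i \<xi>
    using that Jm by (simp add: h'_def J E)
  have "liftable g m (r + 2) (m * q + 2) h' cls' st' \<psi>'"
    unfolding liftable_def
  proof (intro conjI allI impI)
    fix s :: "nat \<Rightarrow> 'a" assume nz: "\<exists>x<r + 2. s x \<noteq> 0"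
    show "\<exists>i<m * q + 2. \<exists>j<m * q + 2. \<exists>c d. c \<noteq> 0 \<and> d \<noteq> 0 \<and> compatible cls' st' i j \<and>
        (\<forall>x<r + 2. s x = c * h' i x + d * h' j x)"
    proof (cases "\<exists>x<r. s x \<noteq> 0")
      case True
      from span[OF True] obtain i j c d where ij: "i < m" "j < m" "i \<noteq> j" and cd: "c \<noteq> 0" "d \<noteq> 0"
        and eq: "\<forall>x<r. s x = c * h i x + d * h j x"
        by blast
      obtain \<xi> \<eta> where sol: "s r = c * (\<xi> * fst (slope_vec (\<beta> i))) + d * (\<eta> * fst (slope_vec (\<beta> j)))"
        "s (Suc r) = c * (\<xi> * snd (slope_vec (\<beta> i))) + d * (\<eta> * snd (slope_vec (\<beta> j)))"
        using slope_vec_solve[OF \<beta>_neq[OF ij] cd] by blast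
      have "compatible cls' st' (J i \<xi>) (J j \<eta>)"
        using ij Jm by (simp add: compatible_def cls'_def J)
      moreover have "\<forall>x<r + 2. s x = c * h' (J i \<xi>) x + d * h' (J j \<eta>) x"
        unfolding h'J[OF ij(1)] h'J[OF ij(2)] using eq sol by (intro extend_vec_combination) auto
      ultimately show ?thesis
        using Jm[OF ij(1), THEN trans_less_add1] Jm[OF ij(2), THEN trans_less_add1] cd by blast
    next
      case False
      then have nz': "s r \<noteq> 0 \<or> s (Suc r) \<noteq> 0"
        using nz by (metis add_2_eq_Suc' less_Suc_eq)
      show ?thesis
      proof (cases "s r \<noteq> 0 \<and> s (Suc r) \<noteq> 0")
        case True
        have h'E: "h' (m * q) = extend_vec r (\<lambda>_. 0) (slope_vec (Some 0)) 1"
          "h' (m * q + 1) = extend_vec r (\<lambda>_. 0) (slope_vec None) 1"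
          by (simp_all add: h'_def)
        have "compatible cls' st' (m * q) (m * q + 1)"
          by (simp add: compatible_def cls'_def)
        moreover have "\<forall>x<r + 2. s x = s r * h' (m * q) x + s (Suc r) * h' (m * q + 1) x"
          unfolding h'E by (rule extend_vec_combination) (use False in simp_all)
        moreover have "m * q < m * q + 2" "m * q + 1 < m * q + 2"
          by simp_all
        ultimately show ?thesis
          using True by blast
      next
        \<comment> \<open>Both coefficients must be nonzero, so a vector with only one nonzero new
          coordinate cannot come from the two extra columns; it is a multiple of a difference inside
          block 0 or 1.\<close>
        case nTrue: False
        then obtain i w where i: "i < 2" "w \<noteq> 0" "s r = w * fst (slope_vec (\<beta> i))"
          "s (Suc r) = w * snd (slope_vec (\<beta> i))"
        proof (cases "s (Suc r) = 0")
          case True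
          then show ?thesis
            using nz' by (intro that[of 0 "s r"]) (auto simp: \<beta>_def)
        next
          case F: False
          then show ?thesis
            using nTrue by (intro that[of 1 "s (Suc r)"]) (auto simp: \<beta>_def)
        qed
        then have im: "i < m"
          using m by simp
        have "compatible cls' st' (J i 1) (J i 0)"
          using i Jm[OF im] by (auto simp: compatible_def st'_def J E01)
        moreover have "\<forall>x<r + 2. s x = w * h' (J i 1) x + (- w) * h' (J i 0) x"
          unfolding h'J[OF im] using False i by (intro extend_vec_combination) auto
        moreover have "- w \<noteq> 0"
          using i by simp
        ultimately show ?thesis
          using Jm[OF im, THEN trans_less_add1] i(2) by blast
      qed
    qed
  next
    fix i assume "i < m * q + 2"
    then show "cls' i < m"
      using m by (auto simp: cls'_def less_mult_imp_div_less)
  next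
    show "inj \<psi>'"
    proof (rule injI)
      fix \<sigma> \<sigma>' assume eq: "\<psi>' \<sigma> = \<psi>' \<sigma>'"
      have "\<psi>' \<rho> div q = g \<rho>" "\<psi>' \<rho> mod q = \<tau> \<rho>" for \<rho>
        using \<tau>(1)[of \<rho>] by (auto simp: \<psi>'_def)
      then show "\<sigma> = \<sigma>'"
        using \<tau>(3) eq by metis
    qed
  next
    fix \<sigma>
    have *: "\<psi>' \<sigma> div q = g \<sigma>" "\<psi>' \<sigma> mod q = \<tau> \<sigma>"
      using \<tau>(1)[of \<sigma>] by (auto simp: \<psi>'_def)
    have "\<psi>' \<sigma> < Suc (g \<sigma>) * q"
      using \<tau>(1)[of \<sigma>] by (simp add: \<psi>'_def)
    also have "\<dots> \<le> m * q"
      using g[of \<sigma>] by (intro mult_le_mono1) auto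
    finally have lt: "\<psi>' \<sigma> < m * q" .
    then show "\<psi>' \<sigma> < m * q + 2"
      by simp
    show "st' (\<psi>' \<sigma>) = 0" "cls' (\<psi>' \<sigma>) = g \<sigma>"
      using * lt \<tau>(2)[of \<sigma>] by (auto simp: st'_def cls'_def)
  qed
  then show ?thesis
    by blast
qed

text \<open>\<open>liftable_base\<close> followed by \<open>k\<close> applications of
  \<open>liftable_step\<close>. The \<open>q + 1\<close> slopes are numbered and distributed by
  residues modulo \<open>m\<close>; \<open>2 * m \<le> q + 1\<close> leaves at least two in every
  class.\<close>

lemma lift_covering:
  fixes h :: "nat \<Rightarrow> nat \<Rightarrow> 'a::{finite,field}"
  defines "q \<equiv> card (UNIV :: 'a set)"
  assumes span: "\<And>s. \<exists>x<r. s x \<noteq> 0 \<Longrightarrow>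
      \<exists>i<m. \<exists>j<m. \<exists>c d. i \<noteq> j \<and> c \<noteq> 0 \<and> d \<noteq> 0 \<and> (\<forall>x<r. s x = c * h i x + d * h j x)"
    and m: "2 \<le> m" "2 * m \<le> q + 1" and q: "5 \<le> q"
  shows "\<exists>h' :: nat \<Rightarrow> nat \<Rightarrow> 'a. \<forall>s. (\<exists>x<r + 2 * Suc k. s x \<noteq> 0) \<longrightarrow>
      (\<exists>i<(m * q + 2) * q ^ k. \<exists>j<(m * q + 2) * q ^ k. \<exists>c d. i \<noteq> j \<and>
         (\<forall>x<r + 2 * Suc k. s x = c * h' i x + d * h' j x))"
proof -
  obtain e0 :: "nat \<Rightarrow> 'a" where e0: "bij_betw e0 {..<q} UNIV"
    using ex_bij_betw_nat_finite[of "UNIV :: 'a set"] by (auto simp: q_def atLeast0LessThan)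
  have "\<exists>e :: nat \<Rightarrow> 'a. bij_betw e {..<q} UNIV \<and> e 0 = 0 \<and> e 1 = 1"
  proof -
    obtain f :: "'a \<Rightarrow> 'a" where f: "bij f" "f (e0 0) = 0" "f (e0 1) = 1"
    proof -
      have ne: "e0 0 \<noteq> e0 1"
        using e0 q by (auto simp: bij_betw_def dest!: inj_onD)
      \<comment> \<open>The second transposition fixes 0 because neither \<open>f1 (e0 1)\<close>
        nor 1 is 0.\<close>
      define f1 where "f1 = transpose (e0 0) (0 :: 'a)"
      define f2 where "f2 = transpose (f1 (e0 1)) (1 :: 'a)"
      have "f1 (e0 0) = 0" "f1 (e0 1) \<noteq> 0"
        using ne by (auto simp: f1_def transpose_def)
      then have "(f2 \<circ> f1) (e0 0) = 0" "(f2 \<circ> f1) (e0 1) = 1"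
        by (auto simp: f2_def transpose_def)
      moreover have "bij (f2 \<circ> f1)"
        by (auto simp: f1_def f2_def intro!: bij_comp)
      ultimately show ?thesis
        using that by blast
    qed
    then show ?thesis
      using bij_betw_trans[OF e0 f(1)] by (intro exI[of _ "f \<circ> e0"]) auto
  qed
  then obtain e :: "nat \<Rightarrow> 'a" where e: "bij_betw e {..<q} UNIV" "e 0 = 0" "e 1 = 1"
    by blast
  have "card (UNIV :: 'a option set) = q + 1"
    by (simp add: q_def UNIV_option_conv card_image)
  then obtain \<nu>' :: "nat \<Rightarrow> 'a option" where \<nu>': "bij_betw \<nu>' {..<q + 1} UNIV"
    using ex_bij_betw_nat_finite[of "UNIV :: 'a option set"] by (auto simp: atLeast0LessThan)
  define \<nu> where "\<nu> = inv_into {..<q + 1} \<nu>'"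
  have \<nu>: "\<nu> \<sigma> < q + 1" "\<nu>' (\<nu> \<sigma>) = \<sigma>" for \<sigma>
    using \<nu>' bij_betw_inv_into_right[OF \<nu>'] inv_into_into[of \<sigma> \<nu>' "{..<q + 1}"]
    unfolding \<nu>_def bij_betw_def by auto
  have \<nu>\<nu>': "\<nu> (\<nu>' i) = i" if "i < q + 1" for i
    using bij_betw_inv_into_left[OF \<nu>', of i] that by (simp add: \<nu>_def)
  define g where "g \<sigma> = \<nu> \<sigma> mod m" for \<sigma>
  \<comment> \<open>Residue and quotient together determine the slope. The quotient is at most
    \<open>q div 2\<close>, and \<open>2 + q div 2 < q\<close> holds from \<open>q = 5\<close>
    on.\<close>
  define \<tau> where "\<tau> \<sigma> = 2 + \<nu> \<sigma> div m" for \<sigma>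
  have \<tau>q: "\<tau> \<sigma> < q" for \<sigma>
  proof -
    have "\<nu> \<sigma> div m \<le> q div 2"
      using \<nu>(1)[of \<sigma>] m by (intro div_le_mono2[THEN order_trans, OF _ m(1)] div_le_mono) auto
    then show ?thesis
      using q by (simp add: \<tau>_def)
  qed
  have \<tau>inj: "\<sigma> = \<sigma>'" if "g \<sigma> = g \<sigma>'" "\<tau> \<sigma> = \<tau> \<sigma>'" for \<sigma> \<sigma>'
  proof -
    have "\<nu> \<sigma> = \<nu> \<sigma>'"
      using that unfolding g_def \<tau>_def by (metis add_left_cancel div_mult_mod_eq)
    then show ?thesis
      using \<nu>(2) by metis
  qed
  \<comment> \<open>\<open>c\<close> and \<open>c + m\<close> have the same residue and are both at
    most \<open>q\<close>, as \<open>c + m < 2 * m\<close>.\<close>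
  have ab: "g (\<nu>' c) = c" "g (\<nu>' (c + m)) = c" "\<nu>' c \<noteq> \<nu>' (c + m)" if "c < m" for c
  proof -
    show "g (\<nu>' c) = c" "g (\<nu>' (c + m)) = c"
      using that m by (auto simp: g_def \<nu>\<nu>')
    show "\<nu>' c \<noteq> \<nu>' (c + m)"
      using that m \<nu>\<nu>'[of c] \<nu>\<nu>'[of "c + m"] by (metis add.commute add_less_cancel_left mult_2 nat_neq_iff not_add_less1 order_less_le_trans trans_less_add1 add_eq_self_zero less_nat_zero_code)
  qed
  have "\<exists>h' cls' st' \<psi>'. liftable g m (r + 2 * Suc k) ((m * q + 2) * q ^ k) h' cls' st' \<psi>'"
  proof (induction k)
    case 0
    have "\<exists>h' cls' st' \<psi>'. liftable g m (r + 2) (m * q + 2) h' cls' st' \<psi>'"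
      by (rule liftable_base[OF span e m(1) _ _ \<tau>q _ \<tau>inj]) (use m in \<open>auto simp: g_def \<tau>_def\<close>)
    then show ?case
      by simp
  next
    case (Suc k)
    then obtain h' cls' st' \<psi>' where
      IH: "liftable g m (r + 2 * Suc k) ((m * q + 2) * q ^ k) h' cls' st' \<psi>'"
      by blast
    have "\<exists>h' cls' st' \<psi>'. liftable g m (r + 2 * Suc k + 2) ((m * q + 2) * q ^ k * q) h' cls' st' \<psi>'"
      by (rule liftable_step[OF IH e _ ab]) (use q in auto)
    moreover have "r + 2 * Suc k + 2 = r + 2 * Suc (Suc k)" "(m * q + 2) * q ^ k * q = (m * q + 2) * q ^ Suc k"
      by (simp_all only: add_Suc_right mult_Suc_right power_Suc2 mult.assoc add.assoc add.commute)
    ultimately show ?case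
      by metis
  qed
  then obtain h' cls' st' \<psi>' where L: "liftable g m (r + 2 * Suc k) ((m * q + 2) * q ^ k) h' cls' st' \<psi>'"
    by blast
  have "i \<noteq> j" if "compatible cls' st' i j" for i j
    using that by (auto simp: compatible_def doubleton_eq_iff)
  then show ?thesis
    using L unfolding liftable_def by (intro exI[of _ h']) meson
qed

section \<open>Saturating sets from linear blocking sets\<close>

text \<open>Subfields are sets inside a fixed field type. Division makes no exception for the
  divisor 0, since \<open>x / 0 = 0\<close>.\<close>

definition subfield_set :: "'a::field set \<Rightarrow> bool" where
  "subfield_set S \<longleftrightarrow> 1 \<in> S \<and> (\<forall>x\<in>S. \<forall>y\<in>S. x - y \<in> S \<and> x * y \<in> S \<and> x / y \<in> S)"

lemma subfield_setD:
  assumes "subfield_set S"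
  shows "0 \<in> S" "1 \<in> S" "x \<in> S \<Longrightarrow> - x \<in> S"
    and "x \<in> S \<Longrightarrow> y \<in> S \<Longrightarrow> x + y \<in> S" "x \<in> S \<Longrightarrow> y \<in> S \<Longrightarrow> x - y \<in> S"
    and "x \<in> S \<Longrightarrow> y \<in> S \<Longrightarrow> x * y \<in> S" "x \<in> S \<Longrightarrow> y \<in> S \<Longrightarrow> x / y \<in> S"
proof -
  have one: "1 \<in> S" and diff: "\<And>x y. x \<in> S \<Longrightarrow> y \<in> S \<Longrightarrow> x - y \<in> S"
    and md: "\<And>x y. x \<in> S \<Longrightarrow> y \<in> S \<Longrightarrow> x * y \<in> S" "\<And>x y. x \<in> S \<Longrightarrow> y \<in> S \<Longrightarrow> x / y \<in> S"
    using assms unfolding subfield_set_def by blast+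
  have zero: "0 \<in> S"
    using diff[OF one one] by simp
  have neg: "- x \<in> S" if "x \<in> S" for x
    using diff[OF zero that] by simp
  have add: "x + y \<in> S" if "x \<in> S" "y \<in> S" for x y
    using diff[OF that(1) neg[OF that(2)]] by simp
  show "0 \<in> S" "1 \<in> S" by fact+
  show "x \<in> S \<Longrightarrow> - x \<in> S" by (rule neg)
  show "x \<in> S \<Longrightarrow> y \<in> S \<Longrightarrow> x + y \<in> S" by (rule add)
  show "x \<in> S \<Longrightarrow> y \<in> S \<Longrightarrow> x - y \<in> S" by (rule diff)
  show "x \<in> S \<Longrightarrow> y \<in> S \<Longrightarrow> x * y \<in> S" by (rule md)
  show "x \<in> S \<Longrightarrow> y \<in> S \<Longrightarrow> x / y \<in> S" by (rule md)
qed

definition linear_functional :: "'a::field set \<Rightarrow> 'a set \<Rightarrow> ('a \<Rightarrow> 'a) \<Rightarrow> bool" where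
  "linear_functional K k L \<longleftrightarrow> (\<forall>x\<in>K. L x \<in> k) \<and> (\<forall>x\<in>K. \<forall>y\<in>K. L (x + y) = L x + L y) \<and>
     (\<forall>c\<in>k. \<forall>x\<in>K. L (c * x) = c * L x)"

section \<open>Linear algebra in dimension three\<close>

fun comb3 :: "'a::field \<Rightarrow> 'a \<times> 'a \<times> 'a \<Rightarrow> 'a \<Rightarrow> 'a \<times> 'a \<times> 'a \<Rightarrow> 'a \<times> 'a \<times> 'a" where
  "comb3 c (x, y, z) d (x', y', z') = (c * x + d * x', c * y + d * y', c * z + d * z')"

fun dot3 :: "'a::field \<times> 'a \<times> 'a \<Rightarrow> 'a \<times> 'a \<times> 'a \<Rightarrow> 'a" where
  "dot3 (x, y, z) (x', y', z') = x * x' + y * y' + z * z'"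

definition independent3 :: "'a::field \<times> 'a \<times> 'a \<Rightarrow> 'a \<times> 'a \<times> 'a \<Rightarrow> bool" where
  "independent3 v w \<longleftrightarrow> (\<forall>c d. comb3 c v d w = (0, 0, 0) \<longrightarrow> c = 0 \<and> d = 0)"

text \<open>Since \<open>l0 \<noteq> 0\<close>, the first coordinate is a combination of the other
  two, and Cramer's rule solves the remaining system; its determinant \<open>D\<close> is nonzero by
  independence.\<close>

lemma plane_span_aux:
  fixes l0 l1 l2 :: "'a::field"
  assumes l: "l0 \<noteq> 0" "l0 * s0 + l1 * s1 + l2 * s2 = 0" "l0 * v0 + l1 * v1 + l2 * v2 = 0"
      "l0 * w0 + l1 * w1 + l2 * w2 = 0"
    and ind: "\<And>c d. c * v0 + d * w0 = 0 \<Longrightarrow> c * v1 + d * w1 = 0 \<Longrightarrow> c * v2 + d * w2 = 0 \<Longrightarrow> c = 0 \<and> d = 0"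
  shows "\<exists>c d. s0 = c * v0 + d * w0 \<and> s1 = c * v1 + d * w1 \<and> s2 = c * v2 + d * w2"
proof -
  have v0: "v0 = (- l1 / l0) * v1 + (- l2 / l0) * v2"
    using l by (simp add: field_simps eq_neg_iff_add_eq_0)
  have w0: "w0 = (- l1 / l0) * w1 + (- l2 / l0) * w2"
    using l by (simp add: field_simps eq_neg_iff_add_eq_0)
  have s0: "s0 = (- l1 / l0) * s1 + (- l2 / l0) * s2"
    using l by (simp add: field_simps eq_neg_iff_add_eq_0)
  define A B where "A = - l1 / l0" and "B = - l2 / l0"
  note v0 = v0[folded A_def B_def] and w0 = w0[folded A_def B_def] and s0 = s0[folded A_def B_def]
  have ind2: "c = 0 \<and> d = 0" if "c * v1 + d * w1 = 0" "c * v2 + d * w2 = 0" for c d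
  proof (rule ind[OF _ that])
    have "c * v0 + d * w0 = A * (c * v1 + d * w1) + B * (c * v2 + d * w2)"
      unfolding v0 w0 by (simp add: algebra_simps)
    then show "c * v0 + d * w0 = 0"
      using that by simp
  qed
  define D where "D = v1 * w2 - v2 * w1"
  have "D \<noteq> 0"
  proof
    assume "D = 0"
    then have "w1 * v2 = v1 * w2"
      by (simp add: D_def mult.commute)
    \<comment> \<open>\<open>D = 0\<close> gives the dependencies with coefficients
      \<open>(w1, - v1)\<close> and \<open>(w2, - v2)\<close>, so all four entries vanish.\<close>
    then have "w1 = 0 \<and> v1 = 0" "w2 = 0 \<and> v2 = 0"
      using ind2[of w1 "- v1"] ind2[of w2 "- v2"] by (auto simp: algebra_simps)
    then show False
      using ind2[of 1 0] by simp
  qed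
  define c d where "c = (s1 * w2 - s2 * w1) / D" and "d = (v1 * s2 - v2 * s1) / D"
  have Dcd: "D * c = s1 * w2 - s2 * w1" "D * d = v1 * s2 - v2 * s1"
    using \<open>D \<noteq> 0\<close> by (simp_all add: c_def d_def)
  have "D * (c * v1 + d * w1) = (D * c) * v1 + (D * d) * w1"
    by (simp add: algebra_simps)
  also have "\<dots> = D * s1"
    unfolding Dcd by (simp add: D_def algebra_simps)
  finally have 1: "D * (c * v1 + d * w1) = D * s1" .
  have "D * (c * v2 + d * w2) = (D * c) * v2 + (D * d) * w2"
    by (simp add: algebra_simps)
  also have "\<dots> = D * s2"
    unfolding Dcd by (simp add: D_def algebra_simps)
  finally have "D * (c * v2 + d * w2) = D * s2" .
  with 1 have 1: "s1 = c * v1 + d * w1" and 2: "s2 = c * v2 + d * w2"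
    using \<open>D \<noteq> 0\<close> by simp_all
  have "s0 = c * v0 + d * w0"
    unfolding s0 v0 w0 1 2 by (simp add: algebra_simps)
  with 1 2 show ?thesis
    by blast
qed

text \<open>A plane has dimension two, so independent vectors in it span it. Permuting coordinates
  brings a nonzero coefficient of \<open>l\<close> to the front.\<close>

lemma plane_span:
  assumes "l \<noteq> (0, 0, 0)" "dot3 l s = 0" "dot3 l v = 0" "dot3 l w = 0" "independent3 v w"
  shows "\<exists>c d. s = comb3 c v d w"
proof -
  obtain l0 l1 l2 where [simp]: "l = (l0, l1, l2)" by (rule prod_cases3)
  obtain s0 s1 s2 where [simp]: "s = (s0, s1, s2)" by (rule prod_cases3)
  obtain v0 v1 v2 where [simp]: "v = (v0, v1, v2)" by (rule prod_cases3)
  obtain w0 w1 w2 where [simp]: "w = (w0, w1, w2)" by (rule prod_cases3)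
  have ind: "c = 0 \<and> d = 0" if "c * v0 + d * w0 = 0" "c * v1 + d * w1 = 0" "c * v2 + d * w2 = 0" for c d
    using assms(5)[unfolded independent3_def, rule_format, of c d] that by simp
  have d: "l0 * s0 + l1 * s1 + l2 * s2 = 0" "l0 * v0 + l1 * v1 + l2 * v2 = 0"
    "l0 * w0 + l1 * w1 + l2 * w2 = 0"
    using assms(2-4) by simp_all
  then have d': "l1 * s1 + l0 * s0 + l2 * s2 = 0" "l1 * v1 + l0 * v0 + l2 * v2 = 0"
    "l1 * w1 + l0 * w0 + l2 * w2 = 0" "l2 * s2 + l1 * s1 + l0 * s0 = 0"
    "l2 * v2 + l1 * v1 + l0 * v0 = 0" "l2 * w2 + l1 * w1 + l0 * w0 = 0"
    by (simp_all only: add_ac)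
  have "l0 \<noteq> 0 \<or> l1 \<noteq> 0 \<or> l2 \<noteq> 0"
    using assms(1) by simp
  then have "\<exists>c d. s0 = c * v0 + d * w0 \<and> s1 = c * v1 + d * w1 \<and> s2 = c * v2 + d * w2"
  proof (elim disjE)
    assume "l0 \<noteq> 0"
    from plane_span_aux[OF this d ind] show ?thesis .
  next
    assume "l1 \<noteq> 0"
    from plane_span_aux[OF this d'(1-3) ind] show ?thesis by blast
  next
    assume "l2 \<noteq> 0"
    from plane_span_aux[OF this d'(4-6) ind] show ?thesis by blast
  qed
  then show ?thesis
    by simp
qed

section \<open>Linear functionals and linear sets in a tower of subfields\<close>

lemma not_inj_onE:
  assumes "\<not> inj_on f A"
  obtains a b where "a \<in> A" "b \<in> A" "a \<noteq> b" "f a = f b"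
  using assms unfolding inj_on_def by blast

text \<open>The tower \<open>k < K\<close> inside a field of degree 2 over \<open>K\<close>. The
  nonzero functional is an assumption here and is later provided by the trace.\<close>

locale field_tower =
  fixes K k :: "'a::{finite,field} set"
  assumes K: "subfield_set K" and k: "subfield_set k" and kK: "k \<subseteq> K"
    and card_K: "card (UNIV :: 'a set) = card K ^ 2" and card_k: "card k < card K"
    and functional_exists: "\<exists>Tr. linear_functional K k Tr \<and> (\<exists>z\<in>K. Tr z \<noteq> 0)"
begin

lemmas K_simps [simp] = subfield_setD[OF K] and k_simps [simp] = subfield_setD[OF k]

lemma k_in_K [simp]: "x \<in> k \<Longrightarrow> x \<in> K"
  using kK by blast

abbreviation functional :: "('a \<Rightarrow> 'a) \<Rightarrow> bool" where
  "functional \<equiv> linear_functional K k"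

lemma functionalD:
  assumes "functional L"
  shows "x \<in> K \<Longrightarrow> L x \<in> k" "x \<in> K \<Longrightarrow> y \<in> K \<Longrightarrow> L (x + y) = L x + L y"
    "c \<in> k \<Longrightarrow> x \<in> K \<Longrightarrow> L (c * x) = c * L x" "L 0 = 0" "x \<in> K \<Longrightarrow> L (- x) = - L x"
    "x \<in> K \<Longrightarrow> y \<in> K \<Longrightarrow> L (x - y) = L x - L y"
proof -
  show 1: "x \<in> K \<Longrightarrow> L x \<in> k" "x \<in> K \<Longrightarrow> y \<in> K \<Longrightarrow> L (x + y) = L x + L y"
    "c \<in> k \<Longrightarrow> x \<in> K \<Longrightarrow> L (c * x) = c * L x" for x y c
    using assms unfolding linear_functional_def by blast+
  show "L 0 = 0"
    using 1(3)[of 0 0] by simp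
  show neg: "x \<in> K \<Longrightarrow> L (- x) = - L x" for x
    using 1(3)[of "- 1" x] by simp
  show "x \<in> K \<Longrightarrow> y \<in> K \<Longrightarrow> L (x - y) = L x - L y"
    using 1(2)[of x "- y"] neg[of y] by simp
qed

lemma functional_scale:
  assumes "functional L" "\<alpha> \<in> K"
  shows "functional (\<lambda>x. L (\<alpha> * x))"
  unfolding linear_functional_def
  using assms(2) by (simp add: functionalD[OF assms(1)] distrib_left mult.left_commute)

text \<open>Multiples of \<open>z\<close> by elements of \<open>k\<close> hit every value, so the
  fibres are translates of the kernel and divide \<open>K\<close> into \<open>card k\<close> equal
  parts.\<close>

lemma card_fibre:
  assumes L: "functional L" and z: "z \<in> K" "L z \<noteq> 0" and c: "c \<in> k"
  shows "card k * card {x \<in> K. L x = c} = card K"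
proof -
  note Ls = functionalD[OF L]
  have eq: "card {x \<in> K. L x = d} = card {x \<in> K. L x = 0}" if d: "d \<in> k" for d
  proof (rule sym, rule bij_betw_same_card)
    define w where "w = (d / L z) * z"
    have dk: "d / L z \<in> k"
      using d Ls(1)[OF z(1)] by simp
    then have "L w = (d / L z) * L z"
      unfolding w_def using z(1) by (rule Ls(3))
    moreover have "w \<in> K"
      unfolding w_def by (intro K_simps(6) k_in_K dk z(1))
    ultimately have w: "w \<in> K" "L w = d"
      using z(2) by simp_all
    show "bij_betw (\<lambda>x. x + w) {x \<in> K. L x = 0} {x \<in> K. L x = d}"
      by (rule bij_betw_byWitness[where f' = "\<lambda>x. x - w"]) (use w in \<open>auto simp: Ls\<close>)
  qed
  have "K = (\<Union>d\<in>k. {x \<in> K. L x = d})"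
    using Ls(1) by auto
  then have "card K = card (\<Union>d\<in>k. {x \<in> K. L x = d})"
    by simp
  also have "\<dots> = (\<Sum>d\<in>k. card {x \<in> K. L x = d})"
    by (rule card_UN_disjoint) auto
  also have "\<dots> = (\<Sum>d\<in>k. card {x \<in> K. L x = c})"
    by (intro sum.cong refl) (simp only: eq eq[OF c])
  finally show ?thesis
    by simp
qed

text \<open>
  Representatives of the projective points of the linear set
  \<open>{(x, L x, b) | x \<in> K, b \<in> k}\<close>, a blocking set of Redei type.
\<close>

definition reps :: "('a \<Rightarrow> 'a) \<Rightarrow> ('a \<times> 'a \<times> 'a) set" where
  "reps L = {(1, 0, 0)} \<union> (\<lambda>(x, b). (x, 1, b)) ` ({x \<in> K. L x = 1} \<times> k) \<union>
     (\<lambda>x. (x, 0, 1)) ` {x \<in> K. L x = 0}"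

text \<open>The fibre over 1, with \<open>card k\<close> choices of \<open>b\<close> for each
  element, contributes \<open>card K\<close>; the kernel with \<open>b = 1\<close> contributes
  \<open>card K div card k\<close>; the nonzero vectors \<open>(x, 0, 0)\<close> share one
  point.\<close>

lemma card_reps:
  assumes L: "functional L" and z: "z \<in> K" "L z \<noteq> 0"
  shows "card (reps L) \<le> card K + card K div card k + 1"
proof -
  have k0: "0 < card k"
    using k_simps(1) by (auto simp: card_gt_0_iff simp del: k_simps)
  have f: "card {x \<in> K. L x = c} = card K div card k" if "c \<in> k" for c
    using card_fibre[OF L z that] k0 by (metis nonzero_mult_div_cancel_left less_numeral_extra(3))
  have "card (reps L) \<le> card {(1 :: 'a, 0 :: 'a, 0 :: 'a)} + card ({x \<in> K. L x = 1} \<times> k) + card {x \<in> K. L x = 0}"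
    unfolding reps_def
    by (intro order_trans[OF card_Un_le] add_mono card_image_le) auto
  also have "card ({x \<in> K. L x = 1} \<times> k) = card K"
    using card_fibre[OF L z k_simps(2)] by (simp add: card_cartesian_product mult.commute)
  finally show ?thesis
    using f[OF k_simps(1)] by simp
qed

text \<open>Divide by \<open>L x\<close>, else by \<open>b\<close>, else by \<open>x\<close>. The
  first two lie in \<open>k\<close>, so \<open>L\<close> commutes with the division.\<close>

lemma reps_exists:
  assumes L: "functional L" and x: "x \<in> K" and b: "b \<in> k" and nz: "x \<noteq> 0 \<or> b \<noteq> 0"
  shows "\<exists>c x' a' b'. c \<noteq> 0 \<and> (x', a', b') \<in> reps L \<and> x = c * x' \<and> L x = c * a' \<and> b = c * b'"
proof -
  note Ls = functionalD[OF L]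
  consider "L x \<noteq> 0" | "L x = 0" "b \<noteq> 0" | "L x = 0" "b = 0"
    by blast
  then show ?thesis
  proof cases
    case 1
    have i: "1 / L x \<in> k" and bk: "b / L x \<in> k"
      using Ls(1)[OF x] b by simp_all
    have "L (1 / L x * x) = 1 / L x * L x"
      using i x by (rule Ls(3))
    moreover have "1 / L x * x \<in> K"
      by (intro K_simps(6) k_in_K i x)
    ultimately have "(x / L x, 1, b / L x) \<in> reps L"
      using 1 bk by (auto simp: reps_def)
    then show ?thesis
      using 1 by (intro exI[of _ "L x"] exI[of _ "x / L x"] exI[of _ 1] exI[of _ "b / L x"]) simp
  next
    case 2
    have i: "1 / b \<in> k"
      using b by simp
    have "L (1 / b * x) = 1 / b * L x"
      using i x by (rule Ls(3))
    moreover have "1 / b * x \<in> K"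
      by (intro K_simps(6) k_in_K i x)
    ultimately have "(x / b, 0, 1) \<in> reps L"
      using 2 by (auto simp: reps_def)
    then show ?thesis
      using 2 by (intro exI[of _ b] exI[of _ "x / b"] exI[of _ 0] exI[of _ 1]) simp
  next
    case 3
    then show ?thesis
      using nz by (intro exI[of _ x] exI[of _ 1] exI[of _ 0]) (auto simp: reps_def)
  qed
qed

lemma card_k_ge_2: "2 \<le> card k"
proof -
  have "card {0, 1 :: 'a} \<le> card k"
    by (intro card_mono) auto
  then show ?thesis
    by simp
qed

text \<open>
  The map \<open>\<tau> \<mapsto> U (1 / (\<tau> + \<omega>)) - \<tau>\<close> from \<open>k\<close> to \<open>k\<close> is made to take the same value at 0 and 1,
  so it misses some \<open>\<epsilon>\<close>, and \<open>\<theta> = \<omega> - \<epsilon>\<close>.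
\<close>

lemma functionals_exist:
  "\<exists>T U \<theta>. functional T \<and> functional U \<and> \<theta> \<in> K \<and> T 1 = 0 \<and> T \<theta> = 1 \<and>
    (\<exists>z\<in>K. U z \<noteq> 0) \<and> (\<forall>\<tau>\<in>k. U (1 / (\<tau> + \<theta>)) \<noteq> \<tau>)"
proof -
  obtain Tr z where Tr: "functional Tr" and z: "z \<in> K" "Tr z \<noteq> 0"
    using functional_exists by blast
  note Trs = functionalD[OF Tr]
  \<comment> \<open>A nonzero kernel element exists because \<open>k\<close> is smaller than
    \<open>K\<close>; scaling by it makes the functional vanish at 1.\<close>
  obtain \<alpha> where \<alpha>: "\<alpha> \<in> K" "\<alpha> \<noteq> 0" "Tr \<alpha> = 0"
  proof -
    have "\<not> inj_on Tr K"
      using card_inj_on_le[of Tr K k] Trs(1) card_k by (auto simp: image_subset_iff)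
    then obtain x y where "x \<in> K" "y \<in> K" "x \<noteq> y" "Tr x = Tr y"
      by (auto simp: inj_on_def)
    then show ?thesis
      using that[of "x - y"] Trs(6) by auto
  qed
  define T where "T = (\<lambda>x. Tr (\<alpha> * x))"
  have T: "functional T"
    unfolding T_def by (rule functional_scale[OF Tr \<alpha>(1)])
  note Ts = functionalD[OF T]
  have T1: "T 1 = 0"
    using \<alpha> by (simp add: T_def)
  \<comment> \<open>Chosen so that \<open>\<alpha> * \<omega>\<close> is \<open>z\<close> divided by
    \<open>Tr z\<close>, whence \<open>T \<omega> = 1\<close>.\<close>
  define \<omega> where "\<omega> = (1 / Tr z) * z / \<alpha>"
  have izk: "1 / Tr z \<in> k"
    using Trs(1)[OF z(1)] by simp
  have wK: "(1 / Tr z) * z \<in> K"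
    by (intro K_simps(6) k_in_K izk z(1))
  have \<omega>: "\<omega> \<in> K" "T \<omega> = 1"
  proof -
    show "\<omega> \<in> K"
      unfolding \<omega>_def using wK \<alpha>(1) by (rule K_simps)
    have "\<alpha> * \<omega> = (1 / Tr z) * z"
      using \<alpha>(2) by (simp add: \<omega>_def)
    then show "T \<omega> = 1"
      using Trs(3)[OF izk z(1)] z by (simp add: T_def)
  qed
  have Tk: "T \<tau> = 0" if "\<tau> \<in> k" for \<tau>
    using Ts(3)[OF that, of 1] T1 by simp
  \<comment> \<open>\<open>T\<close> vanishes on \<open>k\<close> and is 1 at
    \<open>\<omega>\<close>, so no denominator \<open>\<tau> + \<omega>\<close> is zero.\<close>
  have ne0: "\<tau> + \<omega> \<noteq> 0" if "\<tau> \<in> k" for \<tau>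
    using that Ts(2)[of \<tau> \<omega>] Tk[OF that] \<omega> Ts(4) by auto
  have \<omega>0: "\<omega> \<noteq> 0" "1 + \<omega> \<noteq> 0"
    using ne0[of 0] ne0[of 1] by simp_all
  define \<delta> where "\<delta> = 1 / \<omega> - 1 / (1 + \<omega>)"
  have \<delta>: "\<delta> \<in> K" "\<delta> \<noteq> 0"
    using \<omega>(1) \<omega>0 by (simp_all add: \<delta>_def frac_eq_eq)
  \<comment> \<open>Normalised so that \<open>U \<delta> = - 1\<close>, which amounts to
    \<open>f 0 = f 1\<close> below.\<close>
  define \<beta> where "\<beta> = - ((1 / Tr z) * z / \<delta>)"
  have \<beta>: "\<beta> \<in> K"
    unfolding \<beta>_def using K_simps(3)[OF K_simps(7)[OF wK \<delta>(1)]] .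
  define U where "U = (\<lambda>x. Tr (\<beta> * x))"
  have U: "functional U"
    unfolding U_def by (rule functional_scale[OF Tr \<beta>])
  note Us = functionalD[OF U]
  have "\<beta> * \<delta> = - ((1 / Tr z) * z)"
    using \<delta> by (simp add: \<beta>_def)
  then have U\<delta>: "U \<delta> = - 1"
    using Trs(5)[OF wK] Trs(3)[OF izk z(1)] z by (simp add: U_def)
  have invK: "1 / (\<tau> + \<omega>) \<in> K" if "\<tau> \<in> k" for \<tau>
    using that \<omega> by simp
  define f where "f = (\<lambda>\<tau>. U (1 / (\<tau> + \<omega>)) - \<tau>)"
  have fk: "f \<tau> \<in> k" if "\<tau> \<in> k" for \<tau>
    using that Us(1)[OF invK[OF that]] by (simp add: f_def)
  have "f 0 = f 1"
  proof -
    have "U (1 / \<omega>) - U (1 / (1 + \<omega>)) = - 1"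
      using Us(6)[of "1 / \<omega>" "1 / (1 + \<omega>)"] invK[of 0] invK[of 1] U\<delta> by (simp add: \<delta>_def)
    then show ?thesis
      by (simp add: f_def algebra_simps)
  qed
  then have "\<not> inj_on f k"
    using inj_onD[of f k 0 1] by auto
  then have "f ` k \<noteq> k"
    using eq_card_imp_inj_on[of k f] by force
  then obtain \<epsilon> where \<epsilon>: "\<epsilon> \<in> k" "\<epsilon> \<notin> f ` k"
    using fk by blast
  define \<theta> where "\<theta> = \<omega> - \<epsilon>"
  have "\<theta> \<in> K" "T \<theta> = 1"
    using \<omega> \<epsilon>(1) Ts(6)[of \<omega> \<epsilon>] Tk[OF \<epsilon>(1)] by (simp_all add: \<theta>_def)
  moreover have "U (1 / (\<tau> + \<theta>)) \<noteq> \<tau>" if "\<tau> \<in> k" for \<tau>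
  proof
    assume *: "U (1 / (\<tau> + \<theta>)) = \<tau>"
    \<comment> \<open>Shifting the argument by \<open>\<epsilon>\<close> turns the forbidden
      equation into a value \<open>\<epsilon>\<close> of \<open>f\<close>.\<close>
    have "f (\<tau> - \<epsilon>) = \<epsilon>"
      using * by (simp add: f_def \<theta>_def algebra_simps)
    moreover have "\<tau> - \<epsilon> \<in> k"
      using that \<epsilon>(1) by simp
    ultimately show False
      using \<epsilon> by (metis imageI)
  qed
  moreover have "U \<delta> \<noteq> 0"
    using U\<delta> by simp
  ultimately show ?thesis
    using T U T1 \<delta>(1) by blast
qed

text \<open>There are \<open>card K ^ 3\<close> coefficient vectors but only
  \<open>card K ^ 2\<close> values of \<open>dot3 l s\<close>; the difference of two vectors with
  equal value is the required line.\<close>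

lemma exists_line:
  "\<exists>l0\<in>K. \<exists>l1\<in>K. \<exists>l2\<in>K. (l0, l1, l2) \<noteq> (0, 0, 0) \<and> dot3 (l0, l1, l2) s = 0"
proof -
  obtain s0 s1 s2 where s: "s = (s0, s1, s2)" by (rule prod_cases3)
  have K2: "2 \<le> card K"
    using card_k_ge_2 card_k by linarith
  have "\<not> inj_on (\<lambda>l. dot3 l s) (K \<times> K \<times> K)"
  proof
    assume "inj_on (\<lambda>l. dot3 l s) (K \<times> K \<times> K)"
    then have "card (K \<times> K \<times> K) \<le> card (UNIV :: 'a set)"
      by (intro card_inj_on_le[of "\<lambda>l. dot3 l s"]) auto
    then have "card K * (card K * card K) \<le> 1 * (card K * card K)"
      by (simp add: card_K card_cartesian_product power2_eq_square)
    then show False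
      using K2 by (simp only: mult_le_cancel2) auto
  qed
  then obtain a b where ab: "a \<in> K \<times> K \<times> K" "b \<in> K \<times> K \<times> K" "a \<noteq> b" "dot3 a s = dot3 b s"
    by (rule not_inj_onE)
  obtain a0 a1 a2 where a: "a = (a0, a1, a2)" by (rule prod_cases3)
  obtain b0 b1 b2 where b: "b = (b0, b1, b2)" by (rule prod_cases3)
  have "dot3 (a0 - b0, a1 - b1, a2 - b2) s = 0"
    using ab(4) unfolding a b s by (simp add: algebra_simps)
  moreover have "(a0 - b0, a1 - b1, a2 - b2) \<noteq> (0, 0, 0)"
    using ab(3) unfolding a b by auto
  moreover have "a0 - b0 \<in> K" "a1 - b1 \<in> K" "a2 - b2 \<in> K"
    using ab(1,2) unfolding a b by simp_all
  ultimately show ?thesis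
    by blast
qed

text \<open>\<open>K \<times> k\<close> has more elements than \<open>K\<close>, so an additive map
  between them has a nonzero kernel element. Applied to the equation of a line evaluated on a linear
  set, it gives a point of the set on that line.\<close>

lemma additive_kernel:
  assumes f: "\<And>x b x' b'. x \<in> K \<Longrightarrow> x' \<in> K \<Longrightarrow> b \<in> k \<Longrightarrow> b' \<in> k \<Longrightarrow>
      f (x - x') (b - b') = f x b - f x' b'"
    and fK: "\<And>x b. x \<in> K \<Longrightarrow> b \<in> k \<Longrightarrow> f x b \<in> K"
  shows "\<exists>x\<in>K. \<exists>b\<in>k. (x \<noteq> 0 \<or> b \<noteq> 0) \<and> f x b = 0"
proof -
  have "0 < card K"
    using card_k by linarith
  have "\<not> inj_on (\<lambda>(x, b). f x b) (K \<times> k)"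
  proof
    assume "inj_on (\<lambda>(x, b). f x b) (K \<times> k)"
    then have "card (K \<times> k) \<le> card K"
      by (intro card_inj_on_le[of "\<lambda>(x, b). f x b"]) (use fK in auto)
    then show False
      using \<open>0 < card K\<close> card_k_ge_2 by (simp add: card_cartesian_product)
  qed
  then obtain p p' where "p \<in> K \<times> k" "p' \<in> K \<times> k" "p \<noteq> p'" "(\<lambda>(x, b). f x b) p = (\<lambda>(x, b). f x b) p'"
    by (rule not_inj_onE)
  then obtain x b x' b' where *: "x \<in> K" "x' \<in> K" "b \<in> k" "b' \<in> k" "(x, b) \<noteq> (x', b')" "f x b = f x' b'"
    by (cases p; cases p') auto
  then have "f (x - x') (b - b') = 0" "x - x' \<noteq> 0 \<or> b - b' \<noteq> 0" "x - x' \<in> K" "b - b' \<in> k"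
    using f[of x x' b b'] by auto
  then show ?thesis
    by blast
qed

text \<open>A common point has \<open>e \<noteq> 0\<close>, and then
  \<open>D = T y / e + \<theta>\<close> satisfies \<open>x = b / D\<close> and
  \<open>T D = 1\<close>. Comparing the middle coordinates gives
  \<open>y = U (1 / D) * e * D\<close>; applying \<open>T\<close> yields
  \<open>U (1 / D) = T y / e\<close>, which \<open>avoid\<close> forbids. The factor
  \<open>l\<close> is arbitrary in the large field.\<close>

lemma disjoint_linear_sets:
  assumes T: "functional T" and U: "functional U" and \<theta>: "\<theta> \<in> K" "T 1 = 0" "T \<theta> = 1"
    and avoid: "\<And>\<tau>. \<tau> \<in> k \<Longrightarrow> U (1 / (\<tau> + \<theta>)) \<noteq> \<tau>"
    and mem: "x \<in> K" "b \<in> k" "e \<in> k" "y \<in> K"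
    and eq: "x = l * e" "U x = l * y" "b = l * (T y + \<theta> * e)"
  shows "x = 0 \<and> b = 0"
proof (rule ccontr)
  note Ts = functionalD[OF T] and Us = functionalD[OF U]
  assume nz: "\<not> (x = 0 \<and> b = 0)"
  then have l: "l \<noteq> 0"
    using eq by auto
  have e: "e \<noteq> 0"
  proof
    assume "e = 0"
    then have "y = 0"
      using eq l Us(4) by simp
    then show False
      using \<open>e = 0\<close> eq Ts(4) nz by simp
  qed
  define \<tau> where "\<tau> = T y / e"
  have \<tau>: "\<tau> \<in> k"
    using Ts(1)[OF mem(4)] mem(3) by (simp add: \<tau>_def)
  define D where "D = \<tau> + \<theta>"
  have D: "D \<in> K" "T D = 1"
    using \<tau> \<theta> Ts(2)[of \<tau> \<theta>] Ts(3)[OF \<tau>, of 1] by (simp_all add: D_def)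
  have "D \<noteq> 0"
    using D Ts(4) by auto
  have eD: "T y + \<theta> * e = e * D"
    using e by (simp add: D_def \<tau>_def distrib_left)
  have b0: "b \<noteq> 0"
    using eq eD l e \<open>D \<noteq> 0\<close> by simp
  have iD: "1 / D \<in> K"
    using D by simp
  have uk: "U (1 / D) \<in> k"
    by (rule Us(1)[OF iD])
  have "x = b * (1 / D)"
    using eq eD \<open>D \<noteq> 0\<close> by simp
  then have "U x = b * U (1 / D)"
    using Us(3)[OF mem(2) iD] by simp
  then have "l * y = b * U (1 / D)"
    by (simp only: eq(2))
  also have "\<dots> = l * (U (1 / D) * e * D)"
    unfolding eq(3) eD by (simp only: mult_ac)
  finally have "l * y = l * (U (1 / D) * e * D)" .
  then have y: "y = (U (1 / D) * e) * D"
    using l by simp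
  have "U (1 / D) * e \<in> k"
    using uk mem(3) by simp
  then have "T y = U (1 / D) * e"
    using Ts(3)[of "U (1 / D) * e" D] D unfolding y by simp
  then have "\<tau> = U (1 / D)"
    using e by (simp add: \<tau>_def)
  then show False
    using avoid[OF \<tau>] by (simp add: D_def)
qed

text \<open>Every vector lies in a plane with coefficients in \<open>K\<close>, which meets both
  linear sets; the two vectors found are independent by disjointness and span the plane. A vector
  parallel to one of them is split inside its linear set instead, because both coefficients have to
  be nonzero.\<close>

lemma saturating_set_exists:
  "\<exists>h :: nat \<Rightarrow> nat \<Rightarrow> 'a. \<forall>s. (\<exists>x<3. s x \<noteq> 0) \<longrightarrow>
     (\<exists>i<2 * (card K + card K div card k + 1). \<exists>j<2 * (card K + card K div card k + 1).
        \<exists>c d. i \<noteq> j \<and> c \<noteq> 0 \<and> d \<noteq> 0 \<and> (\<forall>x<3. s x = c * h i x + d * h j x))"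
proof -
  obtain T U \<theta> where T: "functional T" and U: "functional U" and \<theta>: "\<theta> \<in> K" "T 1 = 0" "T \<theta> = 1"
    and Unz: "\<exists>z\<in>K. U z \<noteq> 0" and avoid: "\<And>\<tau>. \<tau> \<in> k \<Longrightarrow> U (1 / (\<tau> + \<theta>)) \<noteq> \<tau>"
    using functionals_exist by blast
  note Ts = functionalD[OF T] and Us = functionalD[OF U]
  define S1 where "S1 = {(x, U x, b) | x b. x \<in> K \<and> b \<in> k}"
  define S2 where "S2 = {(e, y, T y + \<theta> * e) | e y. e \<in> k \<and> y \<in> K}"
  \<comment> \<open>Carries \<open>(x, T x, b)\<close> to the vector of \<open>S2\<close> with
    \<open>e = b\<close> and \<open>y = x\<close>; hence \<open>S2\<close> is a linear image of the
    set represented by \<open>reps T\<close>.\<close>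
  define m where "m = (\<lambda>(x, a, b). (b, x, a + \<theta> * b) :: 'a \<times> 'a \<times> 'a)"
  define R where "R = reps U \<union> m ` reps T"
  have finR: "finite R"
    by (simp add: R_def reps_def)
  have cardR: "card R \<le> 2 * (card K + card K div card k + 1)"
  proof -
    have "\<exists>z\<in>K. T z \<noteq> 0"
      using \<theta> by force
    then have "card (reps T) \<le> card K + card K div card k + 1" "card (reps U) \<le> card K + card K div card k + 1"
      using card_reps[OF T] card_reps[OF U] Unz by blast+
    moreover have "card (m ` reps T) \<le> card (reps T)"
      by (rule card_image_le) (simp add: reps_def)
    moreover have "card R \<le> card (reps U) + card (m ` reps T)"
      unfolding R_def by (rule card_Un_le)
    ultimately have "card R \<le> (card K + card K div card k + 1) + (card K + card K div card k + 1)"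
      by (meson add_mono le_trans)
    then show ?thesis
      by (simp only: mult_2)
  qed
  \<comment> \<open>\<open>comb3 c w 0 w\<close> stands for the multiple of \<open>w\<close> by
    \<open>c\<close>.\<close>
  have rep: "\<exists>c w. c \<noteq> 0 \<and> w \<in> R \<and> v = comb3 c w 0 w" if v: "v \<in> S1 \<union> S2" "v \<noteq> (0, 0, 0)" for v
    using v(1)
  proof
    assume "v \<in> S1"
    then obtain x b where x: "v = (x, U x, b)" "x \<in> K" "b \<in> k"
      unfolding S1_def by blast
    then have "x \<noteq> 0 \<or> b \<noteq> 0"
      using v(2) Us(4) by auto
    from reps_exists[OF U x(2,3) this] obtain c x' a' b' where
      "c \<noteq> 0" "(x', a', b') \<in> reps U" "x = c * x'" "U x = c * a'" "b = c * b'"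
      by blast
    then show ?thesis
      using x(1) unfolding R_def by (intro exI[of _ c] exI[of _ "(x', a', b')"]) simp
  next
    assume "v \<in> S2"
    then obtain e y where e: "v = (e, y, T y + \<theta> * e)" "y \<in> K" "e \<in> k"
      unfolding S2_def by blast
    then have "y \<noteq> 0 \<or> e \<noteq> 0"
      using v(2) Ts(4) by auto
    from reps_exists[OF T e(2,3) this] obtain c x' a' b' where c:
      "c \<noteq> 0" "(x', a', b') \<in> reps T" "y = c * x'" "T y = c * a'" "e = c * b'"
      by blast
    then have "m (x', a', b') \<in> R"
      unfolding R_def by blast
    moreover have "v = comb3 c (m (x', a', b')) 0 (m (x', a', b'))"
      unfolding e(1) c(4) unfolding c(3,5) m_def by (simp add: algebra_simps)
    ultimately show ?thesis
      using c(1) by blast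
  qed
  \<comment> \<open>Passes from vectors of the linear sets to their chosen representatives;
    independence keeps the representatives distinct.\<close>
  have pair: "\<exists>w\<in>R. \<exists>w'\<in>R. \<exists>c d. w \<noteq> w' \<and> c \<noteq> 0 \<and> d \<noteq> 0 \<and> s = comb3 c w d w'"
    if v: "v \<in> S1 \<union> S2" "v' \<in> S1 \<union> S2" "independent3 v v'" and s: "s = comb3 c v d v'" "c \<noteq> 0" "d \<noteq> 0"
    for s v v' c d
  proof -
    have ind: "\<And>c d. comb3 c v d v' = (0, 0, 0) \<Longrightarrow> c = 0 \<and> d = 0"
      using v(3) unfolding independent3_def by blast
    have "v \<noteq> (0, 0, 0)" "v' \<noteq> (0, 0, 0)"
      using ind[of 1 0] ind[of 0 1] by (cases v; cases v'; force)+
    then obtain a w a' w' where w: "a \<noteq> 0" "w \<in> R" "v = comb3 a w 0 w" "a' \<noteq> 0" "w' \<in> R" "v' = comb3 a' w' 0 w'"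
      using rep[OF v(1)] rep[OF v(2)] by blast
    obtain w0 w1 w2 where w012: "w = (w0, w1, w2)" by (rule prod_cases3)
    obtain w0' w1' w2' where w012': "w' = (w0', w1', w2')" by (rule prod_cases3)
    have "w \<noteq> w'"
    proof
      assume "w = w'"
      then have "w' = (w0, w1, w2)"
        using w012 by simp
      then have "comb3 a' v (- a) v' = (0, 0, 0)"
        unfolding w(3,6) w012 by (simp add: algebra_simps)
      then show False
        using ind w(4) by blast
    qed
    moreover have "s = comb3 (c * a) w (d * a') w'"
      unfolding s(1) w(3,6) w012 w012' by (simp add: algebra_simps)
    moreover have "c * a \<noteq> 0" "d * a' \<noteq> 0"
      using s w by simp_all
    ultimately show ?thesis
      using w(2,5) by blast
  qed
  \<comment> \<open>Splits off a nonparallel vector: in \<open>S1\<close> this is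
    \<open>(0, 0, 1)\<close>, or \<open>(1, U 1, 0)\<close> when \<open>x = 0\<close>; in
    \<open>S2\<close> it is \<open>(0, 1, 0)\<close>, or \<open>(1, 0, \<theta>)\<close> when
    \<open>e = 0\<close>. The remainder stays in the set by additivity.\<close>
  have split: "\<exists>v'\<in>S1 \<union> S2. \<exists>v''\<in>S1 \<union> S2. independent3 v' v'' \<and> v = comb3 1 v' 1 v''"
    if v: "v \<in> S1 \<union> S2" "v \<noteq> (0, 0, 0)" for v
    using v(1)
  proof
    assume "v \<in> S1"
    then obtain x b where x: "v = (x, U x, b)" "x \<in> K" "b \<in> k"
      unfolding S1_def by blast
    show ?thesis
    proof (cases "x = 0")
      case True
      then have "b \<noteq> 0"
        using x v(2) Us(4) by auto
      have 1: "(1, U 1, 0) \<in> S1"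
        unfolding S1_def by force
      have "(x - 1, U (x - 1), b) \<in> S1"
        using x unfolding S1_def by force
      then have 2: "(x - 1, U x - U 1, b) \<in> S1"
        using Us(6)[of x 1] x(2) by simp
      have "independent3 (1, U 1, 0) (x - 1, U x - U 1, b)"
        using \<open>b \<noteq> 0\<close> True by (auto simp: independent3_def)
      moreover have "v = comb3 1 (1, U 1, 0) 1 (x - 1, U x - U 1, b)"
        by (simp add: x(1))
      ultimately show ?thesis
        using 1 2 by blast
    next
      case False
      have 1: "(0, 0, 1) \<in> S1"
        unfolding S1_def using Us(4) by force
      have 2: "(x, U x, b - 1) \<in> S1"
        using x unfolding S1_def by force
      have "independent3 (0, 0, 1) (x, U x, b - 1)"
        using False by (auto simp: independent3_def)
      moreover have "v = comb3 1 (0, 0, 1) 1 (x, U x, b - 1)"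
        by (simp add: x(1))
      ultimately show ?thesis
        using 1 2 by blast
    qed
  next
    assume "v \<in> S2"
    then obtain e y where e: "v = (e, y, T y + \<theta> * e)" "y \<in> K" "e \<in> k"
      unfolding S2_def by blast
    show ?thesis
    proof (cases "e = 0")
      case True
      then have "y \<noteq> 0"
        using e v(2) Ts(4) by auto
      have "(1, 0, T 0 + \<theta> * 1) \<in> S2"
        unfolding S2_def by force
      then have 1: "(1, 0, \<theta>) \<in> S2"
        using Ts(4) by simp
      have 2: "(e - 1, y, T y + \<theta> * (e - 1)) \<in> S2"
        using e unfolding S2_def by force
      have "independent3 (1, 0, \<theta>) (e - 1, y, T y + \<theta> * (e - 1))"
        using \<open>y \<noteq> 0\<close> True by (auto simp: independent3_def)
      moreover have "v = comb3 1 (1, 0, \<theta>) 1 (e - 1, y, T y + \<theta> * (e - 1))"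
        by (simp add: e(1) algebra_simps)
      ultimately show ?thesis
        using 1 2 by blast
    next
      case False
      have "(0, 1, T 1 + \<theta> * 0) \<in> S2"
        unfolding S2_def by force
      then have 1: "(0, 1, 0) \<in> S2"
        using \<theta> by simp
      have "(e, y - 1, T (y - 1) + \<theta> * e) \<in> S2"
        using e unfolding S2_def by force
      then have 2: "(e, y - 1, T y + \<theta> * e) \<in> S2"
        using Ts(6)[of y 1] e(2) \<theta>(2) by simp
      have "independent3 (0, 1, 0) (e, y - 1, T y + \<theta> * e)"
        using False by (auto simp: independent3_def)
      moreover have "v = comb3 1 (0, 1, 0) 1 (e, y - 1, T y + \<theta> * e)"
        by (simp add: e(1))
      ultimately show ?thesis
        using 1 2 by blast
    qed
  qed
  have cover: "\<exists>w\<in>R. \<exists>w'\<in>R. \<exists>c d. w \<noteq> w' \<and> c \<noteq> 0 \<and> d \<noteq> 0 \<and> s = comb3 c w d w'"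
    if s: "s \<noteq> (0, 0, 0)" for s
  proof -
    obtain l0 l1 l2 where l: "l0 \<in> K" "l1 \<in> K" "l2 \<in> K" "(l0, l1, l2) \<noteq> (0, 0, 0)" "dot3 (l0, l1, l2) s = 0"
      using exists_line by blast
    obtain x b where x: "x \<in> K" "b \<in> k" "x \<noteq> 0 \<or> b \<noteq> 0" "l0 * x + l1 * U x + l2 * b = 0"
      using additive_kernel[of "\<lambda>x b. l0 * x + l1 * U x + l2 * b"] l(1-3) Us(1)
      by (auto simp: Us algebra_simps)
    obtain y e where y: "y \<in> K" "e \<in> k" "y \<noteq> 0 \<or> e \<noteq> 0" "l0 * e + l1 * y + l2 * (T y + \<theta> * e) = 0"
      using additive_kernel[of "\<lambda>y e. l0 * e + l1 * y + l2 * (T y + \<theta> * e)"] l(1-3) Ts(1) \<theta>(1)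
      by (auto simp: Ts algebra_simps)
    define v where "v = (x, U x, b)"
    define v' where "v' = (e, y, T y + \<theta> * e)"
    have v: "v \<in> S1" "v' \<in> S2"
      using x y unfolding v_def v'_def S1_def S2_def by blast+
    have v'0: "v' \<noteq> (0, 0, 0)"
      using y(3) by (auto simp: v'_def)
    have v0: "v \<noteq> (0, 0, 0)"
      using x(3) by (auto simp: v_def)
    have ind: "independent3 v v'"
      unfolding independent3_def
    proof (intro allI impI)
      fix c d assume "comb3 c v d v' = (0, 0, 0)"
      then have eqs: "c * x + d * e = 0" "c * U x + d * y = 0" "c * b + d * (T y + \<theta> * e) = 0"
        unfolding v_def v'_def by simp_all
      have "c = 0"
      proof (rule ccontr)
        assume c: "c \<noteq> 0"
        have "x = (- d / c) * e" "U x = (- d / c) * y" "b = (- d / c) * (T y + \<theta> * e)"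
          using eqs c by (simp_all add: field_simps eq_neg_iff_add_eq_0)
        from disjoint_linear_sets[OF T U \<theta> avoid x(1,2) y(2,1) this] show False
          using x(3) by blast
      qed
      moreover from this have "d = 0"
        using eqs y(3) by auto
      ultimately show "c = 0 \<and> d = 0" ..
    qed
    have "dot3 (l0, l1, l2) v = 0" "dot3 (l0, l1, l2) v' = 0"
      using x(4) y(4) unfolding v_def v'_def by simp_all
    from plane_span[OF l(4,5) this ind] obtain c d where cd: "s = comb3 c v d v'"
      by blast
    show ?thesis
    proof (cases "c \<noteq> 0 \<and> d \<noteq> 0")
      case True
      then show ?thesis
        using pair[of v v' s c d] v ind cd by blast
    next
      case False
      have "\<exists>w\<in>S1 \<union> S2. \<exists>a. w \<noteq> (0, 0, 0) \<and> a \<noteq> 0 \<and> s = comb3 a w 0 w"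
      proof (cases "c = 0")
        case True
        then have "d \<noteq> 0"
          using s cd by (auto simp: v_def v'_def)
        moreover have "s = comb3 d v' 0 v'"
          using cd True by (simp add: v_def v'_def)
        ultimately show ?thesis
          using v v'0 by blast
      next
        case F: False
        then have "s = comb3 c v 0 v"
          using cd False by (simp add: v_def v'_def)
        then show ?thesis
          using v v0 F by blast
      qed
      then obtain w a where w: "w \<in> S1 \<union> S2" "w \<noteq> (0, 0, 0)" "a \<noteq> 0" "s = comb3 a w 0 w"
        by blast
      from split[OF w(1,2)] obtain u u' where u: "u \<in> S1 \<union> S2" "u' \<in> S1 \<union> S2" "independent3 u u'"
        "w = comb3 1 u 1 u'"
        by blast
      obtain u0 u1 u2 where u012: "u = (u0, u1, u2)" by (rule prod_cases3)
      obtain u0' u1' u2' where u012': "u' = (u0', u1', u2')" by (rule prod_cases3)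
      have "s = comb3 a u a u'"
        unfolding w(4) u(4) u012 u012' by (simp add: algebra_simps)
      from pair[OF u(1-3) this w(3) w(3)] show ?thesis .
    qed
  qed
  obtain f where f: "bij_betw f {0..<card R} R"
    using ex_bij_betw_nat_finite[OF finR] by blast
  define h where "h i x = (case f i of (a, b, c) \<Rightarrow> if x = 0 then a else if x = 1 then b else c)" for i x :: nat
  show ?thesis
  proof (intro exI[of _ h] allI impI)
    fix s :: "nat \<Rightarrow> 'a" assume "\<exists>x<3. s x \<noteq> 0"
    then have "(s 0, s 1, s 2) \<noteq> (0, 0, 0)"
      by (auto simp: numeral_3_eq_3 less_Suc_eq numeral_2_eq_2)
    from cover[OF this] obtain w w' c d where w: "w \<in> R" "w' \<in> R" "w \<noteq> w'" "c \<noteq> 0" "d \<noteq> 0"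
      "(s 0, s 1, s 2) = comb3 c w d w'"
      by blast
    obtain i j where ij: "i < card R" "j < card R" "f i = w" "f j = w'"
    proof -
      have "w \<in> f ` {0..<card R}" "w' \<in> f ` {0..<card R}"
        using w(1,2) bij_betw_imp_surj_on[OF f] by blast+
      then show ?thesis
        using that by auto
    qed
    obtain w0 w1 w2 where w012: "w = (w0, w1, w2)" by (rule prod_cases3)
    obtain w0' w1' w2' where w012': "w' = (w0', w1', w2')" by (rule prod_cases3)
    have "s x = c * h i x + d * h j x" if x: "x < 3" for x
    proof -
      consider "x = 0" | "x = 1" | "x = 2"
        using x by linarith
      then show ?thesis
        using w(6) unfolding w012 w012' by cases (simp_all add: h_def ij w012 w012')
    qed
    moreover have "i \<noteq> j"
      using ij w(3) by blast
    moreover have "i < 2 * (card K + card K div card k + 1)" "j < 2 * (card K + card K div card k + 1)"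
      using ij cardR by (meson less_le_trans)+
    ultimately show "\<exists>i<2 * (card K + card K div card k + 1). \<exists>j<2 * (card K + card K div card k + 1).
        \<exists>c d. i \<noteq> j \<and> c \<noteq> 0 \<and> d \<noteq> 0 \<and> (\<forall>x<3. s x = c * h i x + d * h j x)"
      using w(4,5) by blast
  qed
qed

end

section \<open>Subfields of a finite field\<close>

text \<open>Multiplication by a nonzero \<open>x\<close> permutes the nonzero elements; comparing
  the products over them shows that the power with exponent one less is 1.\<close>

lemma finite_field_power_card_same:
  fixes x :: "'a::{finite,field}"
  shows "x ^ card (UNIV :: 'a set) = x"
proof (cases "x = 0")
  case False
  have "(\<Prod>y\<in>UNIV - {0}. x * y) = x ^ (card (UNIV :: 'a set) - 1) * \<Prod>(UNIV - {0})"
    by (simp add: prod.distrib)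
  moreover have "(\<Prod>y\<in>UNIV - {0}. x * y) = \<Prod>(UNIV - {0})"
    by (rule prod.reindex_bij_witness[of _ "\<lambda>y. y / x" "\<lambda>y. x * y"]) (use False in auto)
  moreover have "\<Prod>(UNIV - {0 :: 'a}) \<noteq> 0"
    by simp
  ultimately have "x ^ (card (UNIV :: 'a set) - 1) = 1"
    by simp
  moreover have "card (UNIV :: 'a set) = Suc (card (UNIV :: 'a set) - 1)"
    by (simp add: finite_UNIV_card_ge_0)
  ultimately show ?thesis
    by (metis mult.right_neutral power_Suc)
qed (simp add: finite_UNIV_card_ge_0)

lemma card_power_eq_le:
  fixes a :: "'a::field"
  assumes "0 < m"
  shows "card {x. x ^ m = a} \<le> m"
proof -
  define P where "P = monom 1 m - [:a:]"
  have "coeff P m = 1"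
    using assms by (simp add: P_def coeff_pCons split: nat.split)
  then have nz: "P \<noteq> 0"
    by auto
  have eq: "{x. x ^ m = a} = {x. poly P x = 0}"
    by (simp add: P_def poly_monom)
  have "degree P \<le> m"
    unfolding P_def by (intro degree_diff_le degree_monom_le) simp
  then show "card {x. x ^ m = a} \<le> m"
    unfolding eq using card_poly_roots_bound[OF nz] by linarith
qed

text \<open>Pigeonhole for the power map with exponent \<open>M'\<close>, whose fibres have at most \<open>M'\<close> elements.\<close>

lemma card_roots_of_unity:
  fixes M M' :: nat
  assumes card: "card (UNIV :: 'a::{finite,field} set) = Suc (M * M')" and pos: "0 < M" "0 < M'"
  shows "card {x :: 'a. x ^ M = 1} = M"
proof -
  have one: "x ^ (M * M') = 1" if "x \<noteq> 0" for x :: 'a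
    using finite_field_power_card_same[of x] that unfolding card by simp
  let ?A = "UNIV - {0 :: 'a}" and ?B = "{x :: 'a. x ^ M = 1}"
  have sub: "(\<lambda>x. x ^ M') ` ?A \<subseteq> ?B"
    using one by (auto simp: mult.commute simp flip: power_mult)
  have "M * M' = card ?A"
    using card by (simp add: card_Diff_subset)
  also have "?A \<subseteq> (\<Union>b\<in>?B. {x. x ^ M' = b})"
    using sub by auto
  then have "card ?A \<le> card (\<Union>b\<in>?B. {x. x ^ M' = b})"
    by (intro card_mono) auto
  also have "\<dots> \<le> (\<Sum>b\<in>?B. card {x. x ^ M' = b})"
    by (rule card_UN_le) simp
  also have "\<dots> \<le> (\<Sum>b\<in>?B. M')"
    using pos by (intro sum_mono card_power_eq_le)
  finally have "M * M' \<le> card ?B * M'"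
    by simp
  then have "M \<le> card ?B"
    using pos by simp
  then show ?thesis
    using card_power_eq_le[OF pos(1), of "1 :: 'a"] by simp
qed

section \<open>Fixed fields of Frobenius powers and the trace\<close>

lemma power_minus_1_dvd: "(x :: nat) - 1 dvd x ^ n - 1"
proof (cases "x = 0")
  case True
  then show ?thesis
    by (cases n) auto
next
  case x: False
  show ?thesis
  proof (induction n)
    case (Suc n)
    have "1 \<le> x ^ n"
      using x by simp
    then have "x ^ Suc n - 1 = x * (x ^ n - 1) + (x - 1)"
      using x by (simp add: diff_mult_distrib2)
    then show ?case
      using Suc by simp
  qed simp
qed

text \<open>In a field of order \<open>p ^ N\<close>, for a positive divisor \<open>n\<close> of
  \<open>N\<close>, the case \<open>Q = p ^ n\<close> is the subfield of order
  \<open>Q\<close>.\<close>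

definition frobenius_fixed :: "nat \<Rightarrow> 'a::field set" where
  "frobenius_fixed Q = {x. x ^ Q = x}"

context
  fixes p N :: nat
  assumes p: "prime p" and N: "0 < N" and card: "card (UNIV :: 'a::{finite,field} set) = p ^ N"
begin

lemma CHAR_eq: "CHAR('a) = p"
proof -
  have "0 < CHAR('a)"
    by (rule finite_imp_CHAR_pos) simp
  then have "prime CHAR('a)"
    by (rule prime_CHAR_semidom)
  moreover have "CHAR('a) dvd p ^ N"
    using CHAR_dvd_CARD[where 'a = 'a] card by simp
  ultimately show ?thesis
    using p by (meson prime_dvd_power primes_dvd_imp_eq)
qed

lemma frobenius_add: "(x + y :: 'a) ^ (p ^ n) = x ^ (p ^ n) + y ^ (p ^ n)"
  using p by (intro freshmans_dream'[where n = n]) (simp_all add: CHAR_eq)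

lemma frobenius_sum: "sum f A ^ (p ^ n) = (\<Sum>i\<in>A. (f i :: 'a) ^ (p ^ n))"
  using p by (intro freshmans_dream_sum'[where n = n]) (simp_all add: CHAR_eq)

lemma frobenius_fixed_subfield: "subfield_set (frobenius_fixed (p ^ n) :: 'a set)"
proof -
  have "(x - y) ^ (p ^ n) = x ^ (p ^ n) - y ^ (p ^ n)" for x y :: 'a
    using frobenius_add[of "x - y" y n] by simp
  then show ?thesis
    unfolding subfield_set_def frobenius_fixed_def by (auto simp: power_mult_distrib power_divide)
qed

text \<open>The nonzero fixed elements are the roots of unity of order dividing
  \<open>p ^ n - 1\<close>, and this number divides \<open>p ^ N - 1\<close>.\<close>

lemma card_frobenius_fixed:
  assumes n: "n dvd N" "0 < n"
  shows "card (frobenius_fixed (p ^ n) :: 'a set) = p ^ n"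
proof -
  define M where "M = p ^ n - 1"
  have p2: "2 \<le> p"
    using p by (rule prime_ge_2_nat)
  then have "2 ^ n \<le> p ^ n" "2 \<le> (2 :: nat) ^ n" "2 ^ N \<le> p ^ N" "2 \<le> (2 :: nat) ^ N"
    using n N by (auto intro: power_mono simp: self_le_power)
  then have M: "0 < M" "p ^ n = Suc M" and N1: "2 \<le> p ^ N"
    by (auto simp: M_def)
  obtain d where "N = n * d"
    using n by blast
  then have "M dvd p ^ N - 1"
    unfolding M_def using power_minus_1_dvd[of "p ^ n" d] by (simp add: power_mult)
  then obtain M' where M': "p ^ N - 1 = M * M'"
    by blast
  then have "p ^ N = Suc (M * M')" "0 < M'"
    using N1 by (linarith, cases M') auto
  with card M have c: "card {x :: 'a. x ^ M = 1} = M"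
    by (intro card_roots_of_unity[of M M']) auto
  have "frobenius_fixed (p ^ n) = insert 0 {x :: 'a. x ^ M = 1}"
    unfolding frobenius_fixed_def M by auto
  moreover have "0 \<notin> {x :: 'a. x ^ M = 1}"
    using M(1) by (simp add: zero_power)
  ultimately show ?thesis
    using c M by simp
qed

text \<open>The relative trace. Raising to the power \<open>p ^ e\<close> permutes its terms
  cyclically, so its values are fixed; being given by a nonzero polynomial of degree below
  \<open>p ^ h\<close>, it cannot vanish on all \<open>p ^ h\<close> elements.\<close>

lemma trace_functional:
  assumes e: "0 < e" and h: "h = e * d" "0 < d" and hN: "h dvd N"
  defines "Tr \<equiv> \<lambda>x :: 'a. \<Sum>i<d. x ^ (p ^ (e * i))"
  shows "linear_functional (frobenius_fixed (p ^ h)) (frobenius_fixed (p ^ e)) Tr"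
    and "\<exists>z\<in>frobenius_fixed (p ^ h). Tr z \<noteq> 0"
proof -
  have p2: "2 \<le> p"
    using p by (rule prime_ge_2_nat)
  have "Tr x \<in> frobenius_fixed (p ^ e)" if x: "x \<in> frobenius_fixed (p ^ h)" for x
  proof -
    have "Tr x ^ (p ^ e) = (\<Sum>i<d. x ^ (p ^ (e * Suc i)))"
      unfolding Tr_def frobenius_sum by (simp add: power_add mult.commute flip: power_mult)
    also have "\<dots> = (\<Sum>i<Suc d. x ^ (p ^ (e * i))) - x"
      unfolding sum.lessThan_Suc_shift by simp
    also have "\<dots> = Tr x"
      using x by (simp add: Tr_def frobenius_fixed_def h)
    finally show ?thesis
      by (simp add: frobenius_fixed_def)
  qed
  moreover have "Tr (x + y) = Tr x + Tr y" for x y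
    by (simp add: Tr_def frobenius_add sum.distrib)
  moreover have "Tr (c * x) = c * Tr x" if "c \<in> frobenius_fixed (p ^ e)" for c x
  proof -
    have "c ^ (p ^ (e * i)) = c" for i
      using that by (induction i) (simp_all add: frobenius_fixed_def power_add power_mult)
    then show ?thesis
      by (simp add: Tr_def power_mult_distrib sum_distrib_left)
  qed
  ultimately show "linear_functional (frobenius_fixed (p ^ h)) (frobenius_fixed (p ^ e)) Tr"
    unfolding linear_functional_def by blast
  show "\<exists>z\<in>frobenius_fixed (p ^ h). Tr z \<noteq> 0"
  proof (rule ccontr)
    assume zero: "\<not> ?thesis"
    define P :: "'a poly" where "P = (\<Sum>i<d. monom 1 (p ^ (e * i)))"
    have mono: "p ^ (e * i) < p ^ (e * j)" if "i < j" for i j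
      using that e p2 by (intro power_strict_increasing) auto
    have "coeff P (p ^ (e * 0)) = (\<Sum>i<d. if i = 0 then 1 else 0)"
      unfolding P_def coeff_sum using mono[of 0] by (intro sum.cong) fastforce+
    then have nz: "P \<noteq> 0"
      using h by auto
    have "degree P \<le> p ^ (e * (d - 1))"
      unfolding P_def using p2
      by (intro degree_sum_le order_trans[OF degree_monom_le] power_increasing) auto
    also have "\<dots> < p ^ h"
      unfolding h(1) using h by (intro mono) auto
    finally have deg: "degree P < p ^ h" .
    have "frobenius_fixed (p ^ h) \<subseteq> {x. poly P x = 0}"
      using zero by (auto simp: Tr_def P_def poly_sum poly_monom)
    then have "card (frobenius_fixed (p ^ h) :: 'a set) \<le> card {x. poly P x = 0}"
      by (intro card_mono poly_roots_finite[OF nz])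
    also have "\<dots> \<le> degree P"
      by (rule card_poly_roots_bound[OF nz])
    finally show False
      using deg card_frobenius_fixed[OF hN] h e by simp
  qed
qed

lemma field_tower_frobenius:
  assumes e: "0 < e" "e dvd h" "e < h" and N: "N = 2 * h"
  shows "field_tower (frobenius_fixed (p ^ h) :: 'a set) (frobenius_fixed (p ^ e))"
proof
  obtain d where d: "h = e * d"
    using e by blast
  then have "0 < d"
    using e by (cases d) auto
  have "1 < p"
    using p by (rule prime_gt_1_nat)
  have "h dvd N"
    by (simp add: N)
  note tr = trace_functional[OF e(1) d \<open>0 < d\<close> this]
  show "\<exists>Tr. linear_functional (frobenius_fixed (p ^ h)) (frobenius_fixed (p ^ e)) Tr \<and>
      (\<exists>z\<in>frobenius_fixed (p ^ h). Tr z \<noteq> (0 :: 'a))"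
    using tr by (intro exI conjI)
  show "card (UNIV :: 'a set) = card (frobenius_fixed (p ^ h) :: 'a set) ^ 2"
    using card card_frobenius_fixed[of h] e N by (simp add: power_mult mult.commute)
  show "card (frobenius_fixed (p ^ e) :: 'a set) < card (frobenius_fixed (p ^ h) :: 'a set)"
    using card_frobenius_fixed[of h] card_frobenius_fixed[of e] e N \<open>1 < p\<close>
    by (simp add: power_strict_increasing)
  show "(frobenius_fixed (p ^ e) :: 'a set) \<subseteq> frobenius_fixed (p ^ h)"
  proof
    fix x :: 'a assume x: "x \<in> frobenius_fixed (p ^ e)"
    have "x ^ (p ^ (e * i)) = x" for i
      using x by (induction i) (simp_all add: frobenius_fixed_def power_add power_mult)
    then show "x \<in> frobenius_fixed (p ^ h)"
      by (simp add: frobenius_fixed_def d)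
  qed
qed (rule frobenius_fixed_subfield)+

end

section \<open>Orders of proper subfields and the value of \<open>\<phi>\<close>\<close>

lemma power_minus_1_dvdD:
  fixes p :: nat
  assumes p: "2 \<le> p" and e: "0 < e" and dvd: "p ^ e - 1 dvd p ^ h - 1"
  shows "e dvd h"
proof -
  \<comment> \<open>With \<open>h = e * a + b\<close>, the divisibility passes to
    \<open>p ^ b - 1\<close>, which is smaller than \<open>p ^ e - 1\<close> and hence zero.\<close>
  define a b where "a = h div e" and "b = h mod e"
  have h: "h = e * a + b"
    by (simp add: a_def b_def)
  have pos: "1 \<le> p ^ b" "1 \<le> p ^ (e * a)"
    using p by simp_all
  have "p ^ h - 1 = p ^ b * (p ^ (e * a) - 1) + (p ^ b - 1)"
    using pos by (simp add: h power_add diff_mult_distrib2 mult.commute)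
  moreover have "p ^ e - 1 dvd p ^ b * (p ^ (e * a) - 1)"
    using power_minus_1_dvd[of "p ^ e" a] by (simp add: power_mult)
  ultimately have "p ^ e - 1 dvd p ^ b - 1"
    using dvd by (simp add: dvd_add_right_iff)
  moreover have "p ^ b < p ^ e"
    using p e by (intro power_strict_increasing) (auto simp: b_def)
  ultimately have "p ^ b - 1 = 0"
    using pos(1) by (meson diff_less_mono nat_dvd_not_less not_gr_zero)
  then have "b = 0"
    using p power_strict_increasing[of 0 b p] by (cases "b = 0") auto
  then show ?thesis
    using h by simp
qed

text \<open>Lagrange's theorem for the additive group and for the group of units.\<close>

lemma card_subfield_dvd:
  assumes F: "field F" and fin: "finite (carrier F)" and K: "subfield K F"
  shows "card K dvd card (carrier F)" "card K - 1 dvd card (carrier F) - 1" "2 \<le> card K"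
proof -
  interpret field F by (rule F)
  have sub: "K \<subseteq> carrier F"
    using subfieldE(3)[OF K] .
  have zo: "\<zero>\<^bsub>F\<^esub> \<in> K" "\<one>\<^bsub>F\<^esub> \<in> K"
    using subringE(2,3)[OF subfieldE(1)[OF K]] by blast+
  have finK: "finite K"
    using sub fin finite_subset by blast
  have "subgroup K (add_monoid F)"
    using subfieldE(1)[OF K] unfolding subring_def by blast
  from group.lagrange[OF a_group this]
  have "card (carrier F) = card (rcosets\<^bsub>add_monoid F\<^esub> K) * card K"
    by (simp add: Coset.order_def)
  then show "card K dvd card (carrier F)"
    by simp
  have "subgroup (K - {\<zero>\<^bsub>F\<^esub>}) (units_of F)"
  proof (rule group.subgroupI[OF units_group])
    show "K - {\<zero>\<^bsub>F\<^esub>} \<subseteq> carrier (units_of F)"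
      using sub by (auto simp: units_of_def field_Units)
    show "K - {\<zero>\<^bsub>F\<^esub>} \<noteq> {}"
      using zo one_not_zero by blast
  next
    fix a assume a: "a \<in> K - {\<zero>\<^bsub>F\<^esub>}"
    then have "a \<in> Units F"
      using sub by (auto simp: field_Units)
    then show "inv\<^bsub>units_of F\<^esub> a \<in> K - {\<zero>\<^bsub>F\<^esub>}"
      using subfield_m_inv(1)[OF K a] by (simp add: units_of_inv)
  next
    fix a b assume ab: "a \<in> K - {\<zero>\<^bsub>F\<^esub>}" "b \<in> K - {\<zero>\<^bsub>F\<^esub>}"
    then have "a \<otimes>\<^bsub>F\<^esub> b \<in> K"
      using subringE(6)[OF subfieldE(1)[OF K], of a b] by simp
    moreover have "a \<otimes>\<^bsub>F\<^esub> b \<noteq> \<zero>\<^bsub>F\<^esub>"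
      using ab sub integral[of a b] by (auto simp: subset_iff)
    ultimately show "a \<otimes>\<^bsub>units_of F\<^esub> b \<in> K - {\<zero>\<^bsub>F\<^esub>}"
      by (simp add: units_of_def)
  qed
  from group.lagrange[OF units_group this]
  have "card (carrier F - {\<zero>\<^bsub>F\<^esub>}) =
      card (rcosets\<^bsub>units_of F\<^esub> (K - {\<zero>\<^bsub>F\<^esub>})) * card (K - {\<zero>\<^bsub>F\<^esub>})"
    by (simp add: Coset.order_def units_of_carrier field_Units)
  then have "card (K - {\<zero>\<^bsub>F\<^esub>}) dvd card (carrier F - {\<zero>\<^bsub>F\<^esub>})"
    by simp
  then show "card K - 1 dvd card (carrier F) - 1"
    using zo finK fin sub by (simp add: card_Diff_singleton subset_iff)
  have "card {\<zero>\<^bsub>F\<^esub>, \<one>\<^bsub>F\<^esub>} \<le> card K"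
    using zo finK by (intro card_mono) auto
  then show "2 \<le> card K"
    using one_not_zero by simp
qed

text \<open>The additive divisibility makes the order a power \<open>p ^ e\<close>; the
  multiplicative one forces \<open>e dvd h\<close>.\<close>

lemma card_proper_subfield:
  assumes "prime p" and F: "field F" and card: "card (carrier F) = p ^ h" and K: "subfield K F"
    and ne: "K \<noteq> carrier F"
  shows "\<exists>e. card K = p ^ e \<and> 0 < e \<and> e dvd h \<and> e < h"
proof -
  have p2: "2 \<le> p"
    using assms(1) by (rule prime_ge_2_nat)
  have fin: "finite (carrier F)"
    using card p2 by (metis card.infinite not_numeral_le_zero power_not_zero)
  note dvd = card_subfield_dvd[OF F fin K]
  obtain e where e: "card K = p ^ e"
    using dvd(1) assms(1) unfolding card by (auto simp: divides_primepow_nat)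
  have "0 < e"
    using dvd(3) e by (cases e) auto
  moreover have "e dvd h"
    using dvd(2) power_minus_1_dvdD[OF p2 \<open>0 < e\<close>] unfolding e card by blast
  moreover have "card K < card (carrier F)"
    using subfieldE(3)[OF K] ne fin by (intro psubset_card_mono) auto
  then have "e < h"
    using p2 unfolding e card by (simp add: power_strict_increasing_iff)
  ultimately show ?thesis
    using e by blast
qed

lemma field_of_subfield_set:
  assumes "subfield_set (S :: 'a::field set)"
  shows "field (class_ring\<lparr>carrier := S\<rparr>)" (is "field ?R")
proof -
  note S [simp] = subfield_setD[OF assms]
  have "abelian_group ?R"
    by (rule abelian_groupI) (auto simp: algebra_simps intro: bexI[of _ "- x" for x])
  moreover have "Group.comm_monoid ?R"
    by (rule comm_monoidI) (auto simp: algebra_simps)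
  ultimately have "cring ?R"
    by (rule cringI) (simp add: algebra_simps)
  then show ?thesis
  proof (rule cring.cring_fieldI2)
    show "\<zero>\<^bsub>?R\<^esub> \<noteq> \<one>\<^bsub>?R\<^esub>"
      by simp
    fix a assume "a \<in> carrier ?R" "a \<noteq> \<zero>\<^bsub>?R\<^esub>"
    then show "\<exists>b\<in>carrier ?R. a \<otimes>\<^bsub>?R\<^esub> b = \<one>\<^bsub>?R\<^esub>"
      by (intro bexI[of _ "1 / a"]) auto
  qed
qed

text \<open>\<open>\<phi>\<close> refers to fields with carrier in \<open>nat\<close>, so a pair of
  subfields is carried over along an injection into \<open>nat\<close>.\<close>

lemma nat_field_exists:
  fixes S S' :: "'a::{finite,field} set"
  assumes S: "subfield_set S" and S': "subfield_set S'" and sub: "S' \<subseteq> S"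
  shows "\<exists>K (F :: nat ring). field F \<and> card (carrier F) = card S \<and> subfield K F \<and> card K = card S'"
proof -
  let ?R = "\<lambda>S :: 'a set. class_ring\<lparr>carrier := S\<rparr>"
  interpret R: field "?R S"
    by (rule field_of_subfield_set[OF S])
  obtain enc :: "'a \<Rightarrow> nat" where enc: "inj enc"
    using finite_imp_inj_to_nat_seg[of "UNIV :: 'a set"] by auto
  have inj: "inj_on enc A" for A
    using enc by (rule inj_on_subset) simp
  let ?F = "image_ring enc (?R S)"
  interpret F: field ?F
    by (rule R.inj_imp_image_ring_is_field[OF inj])
  interpret ring_hom_ring "?R S" ?F enc
  proof (rule ring_hom_ringI2)
    show "enc \<in> Ring.ring_hom (?R S) ?F"
      using inj_imp_image_ring_iso[OF inj] unfolding ring_iso_def by blast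
  qed (rule R.ring_axioms F.ring_axioms)+
  have "subfield S' (?R S)"
    using field_of_subfield_set[OF S'] sub by (intro R.subfield_iff(1)) auto
  then have "subfield (enc ` S') ?F"
    using img_is_subfield(2) F.one_not_zero by blast
  moreover have "card (carrier ?F) = card S" "card (enc ` S') = card S'"
    using inj by (simp_all add: image_ring_carrier card_image)
  ultimately show ?thesis
    using F.field_axioms by blast
qed

text \<open>The set under \<open>Max\<close> contains the order of the prime field, proper because
  \<open>2 \<le> h\<close>, and is bounded; its maximum is therefore the order of an actual proper
  subfield.\<close>

lemma largest_proper_subfield_order_prime_power:
  assumes p: "prime p" and h: "2 \<le> h" and card: "card (UNIV :: 'a::{finite,field} set) = p ^ (2 * h)"
  obtains e where "\<phi> (p ^ h) = p ^ e" "0 < e" "e dvd h" "e < h"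
proof -
  let ?S = "{card K | K (F :: nat ring). field F \<and> finite (carrier F) \<and> card (carrier F) = p ^ h \<and>
    subfield K F \<and> K \<noteq> carrier F}"
  have p1: "1 < p"
    using p by (rule prime_gt_1_nat)
  have fix1: "(frobenius_fixed (p ^ 1) :: 'a set) \<subseteq> frobenius_fixed (p ^ h)"
    using field_tower.kK[OF field_tower_frobenius[OF p _ card, of 1 h]] h by simp
  have cards: "card (frobenius_fixed (p ^ h) :: 'a set) = p ^ h" "card (frobenius_fixed (p ^ 1) :: 'a set) = p ^ 1"
    using card_frobenius_fixed[OF p _ card, of h] card_frobenius_fixed[OF p _ card, of 1] h by simp_all
  obtain K F where F: "field (F :: nat ring)" "card (carrier F) = p ^ h" "subfield K F" "card K = p ^ 1"
    using nat_field_exists[OF frobenius_fixed_subfield[OF p _ card] frobenius_fixed_subfield[OF p _ card] fix1] h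
    unfolding cards by auto
  moreover have "p ^ 1 < p ^ h"
    using p1 h by (intro power_strict_increasing) auto
  then have "K \<noteq> carrier F"
    using F(2,4) by auto
  moreover have "finite (carrier F)"
    using F(2) p1 by (metis card.infinite not_one_less_zero power_not_zero)
  ultimately have ne: "?S \<noteq> {}"
    by blast
  have "?S \<subseteq> {..p ^ h}"
    using card_mono[OF _ subfieldE(3)] by fastforce
  then have "finite ?S"
    using finite_subset by blast
  from Max_in[OF this ne] obtain K' F' where F': "\<phi> (p ^ h) = card K'" "field (F' :: nat ring)"
    "card (carrier F') = p ^ h" "subfield K' F'" "K' \<noteq> carrier F'"
    unfolding largest_proper_subfield_order_def by blast
  then show ?thesis
    using card_proper_subfield[OF p F'(2-5)] that by metis
qed

section \<open>Code lengths\<close>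

text \<open>For \<open>t = 1\<close> the saturating set itself is used; otherwise
  \<open>t - 1\<close> liftings raise the codimension from 3 to \<open>2 * t + 1\<close>. Zero
  columns fill up to \<open>N\<close>.\<close>

lemma covering_code_exists:
  fixes p h e t n N :: nat
  assumes p: "prime p" "3 \<le> p" and h: "2 \<le> h"
    and card: "card (UNIV :: 'a::{finite,field} set) = p ^ (2 * h)"
    and e: "0 < e" "e dvd h" "e < h"
    and n: "2 * (p ^ h + p ^ h div p ^ e + 1) \<le> n" and t: "1 \<le> t"
    and N: "n * (p ^ (2 * h)) ^ (t - 1) + (if t = 1 then 0 else 2 * (p ^ (2 * h)) ^ (t - 2)) \<le> N"
    and small: "N < (p ^ (2 * h)) ^ (2 * t)"
  shows "\<exists>C :: 'a vec set. covering_code N (2 * t + 1) 2 C"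
proof -
  define Q where "Q = p ^ h"
  define q where "q = p ^ (2 * h)"
  define m where "m = 2 * (Q + Q div p ^ e + 1)"
  have qQ: "q = Q * Q"
    by (simp add: q_def Q_def mult_2 power_add)
  have "3 ^ 2 \<le> p ^ h"
    using p(2) h by (meson le_trans one_le_numeral power_increasing power_mono zero_le)
  then have Q9: "9 \<le> Q"
    by (simp add: Q_def)
  have "p \<le> p ^ e"
    using p(2) e(1) by (simp add: self_le_power)
  then have "3 \<le> p ^ e"
    using p(2) by simp
  then have "Q div p ^ e \<le> Q div 3"
    by (intro div_le_mono2) auto
  then have m_le: "3 * m \<le> 8 * Q + 6"
    by (simp add: m_def)
  have "9 * Q \<le> q"
    using Q9 by (simp add: qQ)
  \<comment> \<open>\<open>3 * m \<le> 8 * Q + 6\<close> and \<open>9 * Q \<le> q\<close> leave room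
    for two slopes in each of the \<open>m\<close> classes.\<close>
  then have m: "2 \<le> m" "2 * m \<le> q + 1" "5 \<le> q"
    using m_le Q9 by (simp add: m_def, linarith+)
  interpret field_tower "frobenius_fixed (p ^ h) :: 'a set" "frobenius_fixed (p ^ e)"
    using field_tower_frobenius[OF p(1) _ card e] h by simp
  have cards: "card (frobenius_fixed (p ^ h) :: 'a set) = p ^ h" "card (frobenius_fixed (p ^ e) :: 'a set) = p ^ e"
    using card_frobenius_fixed[OF p(1) _ card] e h by (simp_all add: dvd_mult)
  obtain b :: "nat \<Rightarrow> nat \<Rightarrow> 'a" where b: "\<And>s. \<exists>x<3. s x \<noteq> 0 \<Longrightarrow>
      \<exists>i<m. \<exists>j<m. \<exists>c d. i \<noteq> j \<and> c \<noteq> 0 \<and> d \<noteq> 0 \<and> (\<forall>x<3. s x = c * b i x + d * b j x)"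
    using saturating_set_exists unfolding cards m_def Q_def by blast
  have mn: "m \<le> n"
    using n by (simp add: m_def Q_def)
  show ?thesis
  proof (cases "t = 1")
    case True
    have sat: "\<exists>i<m. \<exists>j<m. \<exists>c d. i \<noteq> j \<and> (\<forall>x<2 * t + 1. s x = c * b i x + d * b j x)"
      if "\<exists>x<2 * t + 1. s x \<noteq> 0" for s
    proof -
      have "2 * t + 1 = 3"
        using True by simp
      then show ?thesis
        using b[of s] that by metis
    qed
    show ?thesis
      by (rule covering_codeI[OF _ _ _ sat]) (use N mn True small card in auto)
  next
    case False
    then obtain k where k: "t = Suc (Suc k)"
      using t by (metis One_nat_def Suc_le_D not0_implies_Suc)
    have "\<exists>h' :: nat \<Rightarrow> nat \<Rightarrow> 'a. \<forall>s. (\<exists>x<3 + 2 * Suc k. s x \<noteq> 0) \<longrightarrow>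
      (\<exists>i<(m * q + 2) * q ^ k. \<exists>j<(m * q + 2) * q ^ k. \<exists>c d. i \<noteq> j \<and>
         (\<forall>x<3 + 2 * Suc k. s x = c * h' i x + d * h' j x))"
      using lift_covering[where r = 3 and m = m and h = b and k = k, unfolded card, folded q_def, OF b m] .
    then obtain h' :: "nat \<Rightarrow> nat \<Rightarrow> 'a" where h': "\<And>s. \<exists>x<3 + 2 * Suc k. s x \<noteq> 0 \<Longrightarrow>
      \<exists>i<(m * q + 2) * q ^ k. \<exists>j<(m * q + 2) * q ^ k. \<exists>c d. i \<noteq> j \<and>
         (\<forall>x<3 + 2 * Suc k. s x = c * h' i x + d * h' j x)"
      by blast
    have r: "3 + 2 * Suc k = 2 * t + 1"
      by (simp add: k)
    have "(m * q + 2) * q ^ k \<le> n * q ^ (t - 1) + 2 * q ^ (t - 2)"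
      using mn by (simp add: k add_mult_distrib mult.assoc)
    also have "\<dots> \<le> N"
      using N False by (simp add: q_def)
    finally have le: "(m * q + 2) * q ^ k \<le> N" .
    show ?thesis
      by (rule covering_codeI[OF le _ _ h'[unfolded r]]) (use small card in auto)
  qed
qed

text \<open>The exceptional codimensions 9 and 13 are \<open>t = 4\<close> and \<open>t = 6\<close>;
  the exponents become 1, 0 and 3, 2.\<close>

lemma f_extra_eq:
  assumes "0 < q" and r: "r = 2 * t + 1"
  shows "f_extra q r 2 = real (if t = 4 then q + 1 else if t = 6 then q ^ 3 + q ^ 2 else 0)"
proof -
  have "real r \<in> {9 * real 2 / 2, 13 * real 2 / 2} \<longleftrightarrow> t = 4 \<or> t = 6"
    using r by auto
  moreover have "f_extra q r 2 = real (q + 1)" if "t = 4"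
    using that assms by (simp add: f_extra_def)
  moreover have "f_extra q r 2 = real (q ^ 3 + q ^ 2)" if "t = 6"
  proof -
    have "real q powr 3 = real q ^ 3" "real q powr 2 = real q ^ 2"
      using assms(1) by (simp_all add: powr_numeral)
    then show ?thesis
      using that assms by (simp add: f_extra_def)
  qed
  ultimately show ?thesis
    by (auto simp: f_extra_def)
qed

text \<open>The exponent \<open>(r - 2) / 2\<close> is \<open>t - 1\<close> plus one half, and the
  half power of \<open>q\<close> is \<open>Q\<close>, so only \<open>\<kappa> * Q\<close> has to be
  an integer. For \<open>t = 1\<close> the floor is that of \<open>1 / q\<close>, namely 0.\<close>

lemma code_length_eq:
  fixes \<kappa> :: real
  assumes Q: "2 \<le> Q" and q: "q = Q\<^sup>2" and t: "1 \<le> t" and r: "r = 2 * t + 1" and n: "real n = \<kappa> * real Q"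
  shows "real (n * q ^ (t - 1) + (if t = 1 then 0 else 2 * q ^ (t - 2)) +
      (if t = 4 then q + 1 else if t = 6 then q ^ 3 + q ^ 2 else 0)) =
    \<kappa> * real q powr ((real r - 2) / 2) + 2 * real_of_int \<lfloor>real q powr ((real r - 5) / 2)\<rfloor> + f_extra q r 2"
proof -
  have q0: "0 < q" "1 < real q"
    using Q by (auto simp: q power2_eq_square intro!: less_1_mult)
  have "real q powr ((real r - 2) / 2) = real q powr (real (t - 1) + 1 / 2)"
    using t by (simp add: r field_simps of_nat_diff)
  also have "\<dots> = real q ^ (t - 1) * real Q"
    using q0 by (simp add: powr_add powr_realpow powr_half_sqrt q)
  finally have 1: "real q powr ((real r - 2) / 2) = real q ^ (t - 1) * real Q" .
  have 2: "2 * real_of_int \<lfloor>real q powr ((real r - 5) / 2)\<rfloor> = real (if t = 1 then 0 else 2 * q ^ (t - 2))"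
  proof (cases "t = 1")
    case True
    then have "real q powr ((real r - 5) / 2) = 1 / real q"
      using q0 by (simp add: r powr_minus_divide)
    moreover have "\<lfloor>1 / real q\<rfloor> = 0"
      using q0 by (simp add: floor_eq_iff)
    ultimately show ?thesis
      using True by simp
  next
    case False
    then have "(real r - 5) / 2 = real (t - 2)"
      using t by (simp add: r field_simps of_nat_diff)
    then have "real q powr ((real r - 5) / 2) = real_of_int (int (q ^ (t - 2)))"
      using q0 by (simp add: powr_realpow)
    then have "\<lfloor>real q powr ((real r - 5) / 2)\<rfloor> = int (q ^ (t - 2))"
      by (simp only: floor_of_int)
    then show ?thesis
      using False by simp
  qed
  show ?thesis
    unfolding 1 2 f_extra_eq[OF q0(1) r] using n by simp
qed

theorem theorem6p1:
  fixes p h t q r :: nat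
  assumes "prime p" and "h \<ge> 2" and "q = p ^ (2 * h)"
    and "t \<ge> 1" and "r = 2 * t + 1"
    and "card (UNIV :: 'a::{finite, field} set) = q"
  shows
    "(p \<ge> 3 \<longrightarrow>
       (\<exists>n (C :: 'a vec set). covering_code n r 2 C \<and>
          real n =
            (2 + 2 * ((sqrt (real q) - 1) / (sqrt (real q) * (real (\<phi> (p ^ h)) - 1))))
              * real q powr ((real r - 2) / 2)
            + 2 * real_of_int \<lfloor>real q powr ((real r - 5) / 2)\<rfloor>
            + f_extra q r 2)) \<and>
     (p \<ge> 7 \<longrightarrow>
       (\<exists>n (C :: 'a vec set). covering_code n r 2 C \<and>
          real n =
            (2 + 2 / real p + 2 / sqrt (real q)) * real q powr ((real r - 2) / 2)
            + 2 * real_of_int \<lfloor>real q powr ((real r - 5) / 2)\<rfloor>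
            + f_extra q r 2))"
proof -
  define Q where "Q = p ^ h"
  have p2: "2 \<le> p"
    using assms(1) by (rule prime_ge_2_nat)
  have q: "q = Q\<^sup>2"
    by (simp add: assms(3) Q_def mult.commute flip: power_mult)
  have sq: "sqrt (real q) = real Q"
    by (simp add: q)
  obtain e where phi: "\<phi> (p ^ h) = p ^ e" and e: "0 < e" "e dvd h" "e < h"
    using largest_proper_subfield_order_prime_power[OF assms(1,2)] assms(3,6) by metis
  obtain d where d: "h = e * d"
    using e by blast
  have d2: "2 \<le> d"
    using d e by (cases d; cases "d - 1") auto
  \<comment> \<open>\<open>Q\<close> divided by the subfield order, and at least that order because
    \<open>2 * e \<le> h\<close>.\<close>
  define u where "u = Q div p ^ e"
  have Qu: "Q = p ^ e * u" and su: "p ^ e \<le> u"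
  proof -
    have "h = e + (h - e)"
      using e by simp
    then have Q': "Q = p ^ e * p ^ (h - e)"
      unfolding Q_def by (metis power_add)
    then have u: "u = p ^ (h - e)"
      using p2 by (simp add: u_def)
    then show "Q = p ^ e * u"
      using Q' by simp
    have "2 * e \<le> h"
      using d d2 by simp
    then show "p ^ e \<le> u"
      unfolding u using p2 by (intro power_increasing) auto
  qed
  have ps: "p \<le> p ^ e"
    using e p2 by (simp add: self_le_power)
  \<comment> \<open>Common to both claims: \<open>m\<close> is the number of columns, padding
    included, in codimension 3. The bound \<open>m \<le> q\<close> keeps the total length below
    \<open>q ^ (2 * t)\<close>, as the counting argument for the radius requires.\<close>
  have code: "\<exists>n (C :: 'a vec set). covering_code n r 2 C \<and>
      real n = \<kappa> * real q powr ((real r - 2) / 2)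
        + 2 * real_of_int \<lfloor>real q powr ((real r - 5) / 2)\<rfloor> + f_extra q r 2"
    if p3: "3 \<le> p" and m: "2 * (Q + u + 1) \<le> m" "m \<le> q" "real m = \<kappa> * real Q" for m :: nat and \<kappa>
  proof -
    define a where "a = (if t = 1 then 0 else 2 * q ^ (t - 2))"
    define f where "f = (if t = 4 then q + 1 else if t = 6 then q ^ 3 + q ^ 2 else 0)"
    define N where "N = m * q ^ (t - 1) + a + f"
    have "3 \<le> Q"
    proof -
      have "p \<le> Q"
        using p2 assms(2) unfolding Q_def by (simp add: self_le_power)
      then show ?thesis
        using p3 by simp
    qed
    then have Q2: "2 \<le> Q" and q9: "9 \<le> q"
      using mult_le_mono[of 3 Q 3 Q] by (auto simp: q power2_eq_square)
    have le: "q ^ i \<le> q ^ t" if "i \<le> t" for i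
      using that q9 by (intro power_increasing) auto
    have "m * q ^ (t - 1) \<le> q * q ^ (t - 1)"
      using m by simp
    also have "\<dots> = q ^ t"
      using assms(4) by (simp add: power_eq_if)
    finally have 1: "m * q ^ (t - 1) \<le> q ^ t" .
    have 2: "a \<le> 2 * q ^ t"
      using le[of "t - 2"] by (simp add: a_def)
    have 3: "f \<le> 2 * q ^ t"
      using le[of 1] le[of 0] le[of 2] le[of 3] by (auto simp: f_def)
    have "N \<le> 5 * q ^ t"
      using 1 2 3 by (simp add: N_def)
    also have "\<dots> < q * q ^ t"
      using q9 by simp
    also have "\<dots> \<le> q ^ t * q ^ t"
      using le[of 1] assms(4) by simp
    finally have small: "N < q ^ (2 * t)"
      by (simp add: mult_2 power_add)
    have "\<exists>C :: 'a vec set. covering_code N (2 * t + 1) 2 C"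
    proof (rule covering_code_exists[OF assms(1) p3 assms(2) assms(6)[unfolded assms(3)] e _ assms(4)])
      show "2 * (p ^ h + p ^ h div p ^ e + 1) \<le> m"
        using m(1) by (simp add: Q_def u_def)
      show "m * (p ^ (2 * h)) ^ (t - 1) + (if t = 1 then 0 else 2 * (p ^ (2 * h)) ^ (t - 2)) \<le> N"
        unfolding assms(3)[symmetric] N_def a_def by simp
      show "N < (p ^ (2 * h)) ^ (2 * t)"
        unfolding assms(3)[symmetric] by (rule small)
    qed
    moreover have "real N = \<kappa> * real q powr ((real r - 2) / 2)
        + 2 * real_of_int \<lfloor>real q powr ((real r - 5) / 2)\<rfloor> + f_extra q r 2"
      unfolding N_def a_def f_def by (rule code_length_eq[OF Q2 q assms(4,5) m(3)])
    ultimately show ?thesis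
      using assms(5) by blast
  qed
  show ?thesis
  proof (intro conjI impI)
    assume p3: "3 \<le> p"
    define s where "s = p ^ e"
    have s3: "3 \<le> s"
      using ps p3 by (simp add: s_def)
    have "s - 1 dvd Q - 1"
      using power_minus_1_dvd[of s d] by (simp add: s_def Q_def d power_mult)
    \<comment> \<open>\<open>v\<close> is \<open>(Q - 1) / (s - 1)\<close>, so that the prescribed
      length in codimension 3 is \<open>2 * Q + 2 * v\<close>.\<close>
    then obtain v where v: "Q - 1 = (s - 1) * v"
      by blast
    have Q1: "1 \<le> Q"
      using p2 by (simp add: Q_def)
    have sQ: "s * s \<le> Q"
      using Qu su by (simp add: s_def)
    have uv: "u + 1 \<le> v"
    proof -
      have "(s - 1) * (u + 1) \<le> (s - 1) * v"
      proof -
        \<comment> \<open>Together with \<open>s \<le> u\<close> this bounds the product by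
          \<open>Q - 1\<close>, which is \<open>(s - 1) * v\<close>.\<close>
        have "(s - 1) * (u + 1) + u + 1 = s * u + s"
          using s3 by (cases s) auto
        then have "(s - 1) * (u + 1) \<le> s * u - 1"
          using su by (simp add: s_def)
        then show ?thesis
          using v Qu by (simp add: s_def)
      qed
      moreover have "0 < s - 1"
        using s3 by simp
      ultimately show ?thesis
        by (simp only: mult_le_cancel1)
    qed
    have "2 * v \<le> (s - 1) * v"
      using s3 by (intro mult_le_mono1) simp
    then have "2 * v \<le> Q - 1"
      by (simp only: v)
    then have "2 * Q + 2 * v \<le> 3 * Q"
      by linarith
    also have "\<dots> \<le> Q * Q"
      using sQ s3 mult_le_mono[of 3 s 3 s] by (intro mult_le_mono1) simp
    finally have le: "2 * Q + 2 * v \<le> q"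
      by (simp add: q power2_eq_square)
    have "real (Q - 1) = real ((s - 1) * v)"
      by (simp only: v)
    then have rv: "real Q - 1 = (real s - 1) * real v"
      using s3 Q1 by (simp add: of_nat_diff)
    have eq: "real (2 * Q + 2 * v) =
        (2 + 2 * ((sqrt (real q) - 1) / (sqrt (real q) * (real (\<phi> (p ^ h)) - 1)))) * real Q"
      unfolding sq phi s_def[symmetric] rv using Q1 s3 by (simp add: field_simps)
    from code[OF p3 _ le eq] uv show "\<exists>n (C :: 'a vec set). covering_code n r 2 C \<and>
          real n =
            (2 + 2 * ((sqrt (real q) - 1) / (sqrt (real q) * (real (\<phi> (p ^ h)) - 1))))
              * real q powr ((real r - 2) / 2)
            + 2 * real_of_int \<lfloor>real q powr ((real r - 5) / 2)\<rfloor>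
            + f_extra q r 2"
      by simp
  next
    assume p7: "7 \<le> p"
    then have p3: "3 \<le> p"
      by simp
    \<comment> \<open>\<open>v\<close> is \<open>Q / p\<close>, at least \<open>u\<close> because
      \<open>p \<le> p ^ e\<close>; so this length suffices whichever proper subfield is the
      largest.\<close>
    define v where "v = p ^ (h - 1)"
    have Qv: "Q = p * v"
      using assms(2) by (simp add: Q_def v_def power_eq_if)
    have "u \<le> v"
    proof -
      have "p * u \<le> p * v"
        using Qu Qv ps by (metis mult_le_mono1)
      then show ?thesis
        using p2 by simp
    qed
    have v1: "1 \<le> v"
      using p2 by (simp add: v_def)
    have "7 * v \<le> Q"
      using p7 unfolding Qv by (intro mult_le_mono1)
    then have "2 * (Q + v + 1) \<le> 3 * Q"
      using v1 by simp
    also have "\<dots> \<le> Q * Q"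
      using \<open>7 * v \<le> Q\<close> v1 by (intro mult_le_mono1) simp
    finally have le: "2 * (Q + v + 1) \<le> q"
      by (simp add: q power2_eq_square)
    have eq: "real (2 * (Q + v + 1)) = (2 + 2 / real p + 2 / sqrt (real q)) * real Q"
      unfolding sq using v1 p2 by (simp add: Qv field_simps)
    from code[OF p3 _ le eq] \<open>u \<le> v\<close> show "\<exists>n (C :: 'a vec set). covering_code n r 2 C \<and>
          real n =
            (2 + 2 / real p + 2 / sqrt (real q)) * real q powr ((real r - 2) / 2)
            + 2 * real_of_int \<lfloor>real q powr ((real r - 5) / 2)\<rfloor>
            + f_extra q r 2"
      by simp
  qed
qed

end
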